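(* Let $k\ge 2$ be an integer. Define \[P_k(z)=\frac{(2\pi)^{2k-1}}{(2k)!}\sum_{j=0}^{k}(-1)^j B_{2j}B_{2k-2j}\binom{2k}{2j}z^{2j}+\zeta(2k-1)\left(z^{2k-1}+(-1)^k z\right)\] and \[Q_{k}(z)=(2^{2k}+1)P_k(z)-2^{2k}P_k(z/2)- P_k(2z),\] which equals \[Q_k(z)=\frac{(2\pi)^{2k-1}}{(2k)!}\sum_{j=0}^k (-1)^j B_{2j}B_{2k-2j}(2^{2j}-1)(2^{2k-2j}-1)\binom{2k}{2j} z^{2j}+ \zeta(2k-1)(2^{2k-1}-1)\left((-1)^k z+z^{2k-1}\right).\] Then all of the non-zero roots of $Q_k(z)$ lie on the unit circle $|z|=1$, and all of the zeros of $Q_k(z)$ are simple.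
   Context: $B_n$ denotes the $n$th Bernoulli number, defined by $\dfrac{t}{e^t-1}=\sum_{n\ge0}B_n\dfrac{t^n}{n!}$, and $\zeta$ is the Riemann zeta function. *)

theory Defs
  imports
    "HOL-Analysis.Analysis"
    "HOL-Computational_Algebra.Computational_Algebra"
begin

definition bernoulli :: "nat \<Rightarrow> real" where
  "bernoulli n = fact n * fps_nth (fps_X / (fps_exp 1 - 1)) n"

text \<open>Division of formal power series is total; the quotient above is a genuine one.\<close>

lemma bernoulli_generating_function:
  "Abs_fps (\<lambda>n. bernoulli n / fact n) * (fps_exp 1 - 1) = fps_X"
proof -
  have nz: "fps_exp (1::real) - 1 \<noteq> 0"
  proof
    assume "fps_exp (1::real) - 1 = 0"
    then have "fps_nth (fps_exp (1::real) - 1) 1 = 0" by simp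
    then show False by simp
  qed
  have "subdegree (fps_exp (1::real) - 1) = 1"
    by (rule subdegreeI) auto
  then have dvd: "fps_exp (1::real) - 1 dvd fps_X"
    using nz by (simp add: fps_dvd_iff)
  have "Abs_fps (\<lambda>n. bernoulli n / fact n) = fps_X / (fps_exp 1 - 1)"
    by (rule fps_ext) (simp add: bernoulli_def)
  with dvd show ?thesis by simp
qed

text \<open>The Dirichlet series converges, and represents the Riemann zeta function, for
  \<open>Re s > 1\<close>; outside that half-plane the value below has no meaning. Only the values at the
  integers \<open>2 k - 1 \<ge> 3\<close> are used.\<close>

definition zeta :: "complex \<Rightarrow> complex" where
  "zeta s = (\<Sum>n. 1 / of_nat (Suc n) powr s)"

definition P :: "nat \<Rightarrow> complex poly" where
  "P k = smult (of_real ((2 * pi) ^ (2 * k - 1) / fact (2 * k)))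
           (\<Sum>j = 0..k. monom (of_real ((-1) ^ j * bernoulli (2 * j) * bernoulli (2 * k - 2 * j)
              * of_nat ((2 * k) choose (2 * j)))) (2 * j))
         + smult (zeta (2 * of_nat k - 1)) (monom 1 (2 * k - 1) + monom ((-1) ^ k) 1)"

text \<open>\<open>pcompose p [:0, c:]\<close> is the polynomial \<open>p(c z)\<close>.\<close>

definition Q :: "nat \<Rightarrow> complex poly" where
  "Q k = smult (2 ^ (2 * k) + 1) (P k) - smult (2 ^ (2 * k)) (pcompose (P k) [:0, 1 / 2:])
         - pcompose (P k) [:0, 2:]"

end

theory Submission
  imports Defs "HOL-Real_Asymp.Real_Asymp"
begin

text \<open>
  Let \<open>\<lambda>(s)\<close> be the sum of \<open>n\<^sup>-\<^sup>s\<close> over odd \<open>n\<close>. Euler's formula for \<open>B\<^sub>2\<^sub>j\<close> turns \<open>Q\<^sub>k(z)\<close> into a constant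
  times \<open>z A(z)\<close>, where
  \<open>A(z) = \<lambda>(2k-1) (1 + (-1)\<^sup>k z\<^bsup>2k-2\<^esup>) + 4/\<pi> \<Sum>\<^sub>j (-1)\<^sup>j \<lambda>(2j) \<lambda>(2k-2j) z\<^bsup>2j-1\<^esup>\<close>.
  As \<open>\<lambda>(s)\<close> tends to \<open>1\<close> rapidly, multiplication by \<open>1 + z\<^sup>2\<close> makes all but the outermost coefficients
  tiny, and \<open>(1 + z\<^sup>2) A(z) = p(z) + (-1)\<^sup>k z\<^bsup>2k\<^esup> p(1/z)\<close> with \<open>p\<close> real of degree less than \<open>k\<close>. For
  \<open>k \<ge> 4\<close> the polynomial \<open>p(-u)\<close> is close to \<open>1 + \<pi>/2 u + u\<^sup>2 + 0.27 u\<^sup>3\<close>, which has no zeros in the closed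
  unit disc. Hence \<open>z\<^bsup>2k\<^esup> p(1/z) / p(z)\<close> is a finite Blaschke product, which takes the value
  \<open>-(-1)\<^sup>k\<close> only on the unit circle and with nonzero derivative. For \<open>k = 2, 3\<close> the zeros of \<open>p\<close> lie
  on the circle itself, but \<open>A\<close> splits into explicit factors of degree at most two.
\<close>

section \<open>The Dirichlet lambda function at integers\<close>

definition lam :: "nat \<Rightarrow> real" where
  "lam s = (\<Sum>n. 1 / (2 * real n + 1) ^ s)"

lemma summable_inverse_odd_power:
  assumes "s \<ge> 2"
  shows "summable (\<lambda>n. 1 / (2 * real n + 1) ^ s)"
proof (rule summable_comparison_test')
  have "summable (\<lambda>n. inverse (real n ^ s))"
    using assms by (rule inverse_power_summable)
  then show "summable (\<lambda>n. inverse (real (Suc n) ^ s))"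
    by (subst summable_Suc_iff)
next
  fix n :: nat
  have "real (Suc n) ^ s \<le> (2 * real n + 1) ^ s"
    by (rule power_mono) auto
  then show "norm (1 / (2 * real n + 1) ^ s) \<le> inverse (real (Suc n) ^ s)"
    by (simp add: divide_simps)
qed

lemma lam_sums: "s \<ge> 2 \<Longrightarrow> (\<lambda>n. 1 / (2 * real n + 1) ^ s) sums lam s"
  unfolding lam_def by (intro summable_sums summable_inverse_odd_power)

lemma lam_has_sum:
  "s \<ge> 2 \<Longrightarrow> ((\<lambda>n. 1 / (2 * real n + 1) ^ s) has_sum lam s) UNIV"
  by (rule sums_nonneg_imp_has_sum) (auto simp: lam_sums)

section \<open>Double series over pairs of odd integers, and a convolution identity\<close>

lemma has_sum_sum:
  fixes f :: "'i \<Rightarrow> 'a \<Rightarrow> 'b :: topological_comm_monoid_add"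
  assumes "\<And>i. i \<in> I \<Longrightarrow> (f i has_sum S i) A"
  shows "((\<lambda>x. \<Sum>i\<in>I. f i x) has_sum (\<Sum>i\<in>I. S i)) A"
  using assms by (induction I rule: infinite_finite_induct) (auto intro!: has_sum_add)

text \<open>Telescoping with gap \<open>p\<close>: the interior terms cancel, and only the first
  \<open>p\<close> values and \<open>p\<close> values from index \<open>N\<close> onwards
  survive.\<close>

lemma sum_diff_shift:
  fixes c :: "nat \<Rightarrow> 'a :: ab_group_add"
  shows "(\<Sum>n<N. c n - c (n + p)) = (\<Sum>i<p. c i) - (\<Sum>i<p. c (N + i))"
proof (induction N)
  case (Suc N)
  have "(\<Sum>i<p. c (Suc N + i)) + c N = (\<Sum>i<p. c (N + i)) + c (N + p)"
    using sum.lessThan_Suc_shift[of "\<lambda>i. c (N + i)" p]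
    by (simp add: add.commute)
  then have "c N - c (N + p) = (\<Sum>i<p. c (N + i)) - (\<Sum>i<p. c (Suc N + i))"
    by (simp add: algebra_simps)
  then show ?case using Suc by (simp del: add_Suc add_Suc_right)
qed simp

text \<open>With \<open>d = n - m\<close> and \<open>M = 2 * m + 1\<close>, the denominator is
  \<open>4 * d * (d + M)\<close>. Partial fractions turn the series into one that telescopes with
  gap \<open>M\<close>; its first \<open>M\<close> values cancel in pairs around index
  \<open>m\<close>, so only the correction at the excluded index \<open>n = m\<close>
  contributes.\<close>

lemma odd_square_diff_sums:
  "(\<lambda>n. if n = m then 0 else 1 / ((2 * real n + 1)\<^sup>2 - (2 * real m + 1)\<^sup>2))
     sums (1 / (4 * (2 * real m + 1)\<^sup>2))"
proof -
  define c where "c = (\<lambda>n. 1 / (real n - real m))"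
  define M where "M = 2 * real m + 1"
  have M: "M > 0" by (simp add: M_def)
  \<comment> \<open>Here \<open>c m = 1 / 0 = 0\<close>.\<close>
  have antisym: "(\<Sum>i<2 * m + 1. c i) = 0"
  proof -
    have "(\<Sum>i<2 * m + 1. c i) = (\<Sum>i<2 * m + 1. c (2 * m + 1 - Suc i))"
      by (rule sum.nat_diff_reindex[symmetric])
    also have "\<dots> = (\<Sum>i<2 * m + 1. - c i)"
    proof (rule sum.cong)
      fix i assume "i \<in> {..<2 * m + 1}"
      then have "real (2 * m + 1 - Suc i) = 2 * real m - real i"
        by (simp add: of_nat_diff)
      then have "real (2 * m + 1 - Suc i) - real m = - (real i - real m)" by simp
      then show "c (2 * m + 1 - Suc i) = - c i"
        unfolding c_def by (metis divide_minus_right)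
    qed simp
    finally show ?thesis by (simp add: sum_negf)
  qed
  have "(\<lambda>N. c (N + i)) \<longlonglongrightarrow> 0" for i
    unfolding c_def by real_asymp
  then have "(\<lambda>N. 0 - (\<Sum>i<2 * m + 1. c (N + i))) \<longlonglongrightarrow> 0 - (\<Sum>i<2 * m + 1. 0)"
    by (intro tendsto_intros)
  then have "(\<lambda>n. c n - c (n + (2 * m + 1))) sums 0"
    unfolding sums_def sum_diff_shift antisym by simp
  \<comment> \<open>Since \<open>c m = 0\<close>, the telescoping series has the term
    \<open>- 1 / M\<close> at \<open>n = m\<close>; adding \<open>1 / M\<close> there turns it into
    the required 0.\<close>
  moreover have "(\<lambda>n. if n = m then 1 / M else 0) sums (1 / M)"
    by (rule sums_single)
  ultimately have "(\<lambda>n. (c n - c (n + (2 * m + 1))) + (if n = m then 1 / M else 0)) sums (0 + 1 / M)"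
    by (rule sums_add)
  then have *: "(\<lambda>n. (1 / (4 * M)) * ((c n - c (n + (2 * m + 1))) + (if n = m then 1 / M else 0)))
      sums ((1 / (4 * M)) * (0 + 1 / M))"
    by (rule sums_mult)
  have "(1 / (4 * M)) * ((c n - c (n + (2 * m + 1))) + (if n = m then 1 / M else 0)) =
      (if n = m then 0 else 1 / ((2 * real n + 1)\<^sup>2 - M\<^sup>2))" for n
  proof (cases "n = m")
    case True
    then show ?thesis by (simp add: c_def M_def)
  next
    case False
    define d where "d = real n - real m"
    have d: "d \<noteq> 0" using False by (simp add: d_def)
    have dM: "d + M \<noteq> 0"
    proof -
      have "d + M = real n + real m + 1" by (simp add: d_def M_def)
      then show ?thesis by linarith
    qed
    have "(2 * real n + 1)\<^sup>2 - M\<^sup>2 = 4 * d * (d + M)"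
      by (simp add: d_def M_def power2_eq_square algebra_simps)
    moreover have "c n = 1 / d" "c (n + (2 * m + 1)) = 1 / (d + M)"
      by (simp_all add: c_def d_def M_def algebra_simps)
    ultimately show ?thesis
      using False d dM M by (simp add: divide_simps del: eq_divide_eq)
  qed
  with * have "(\<lambda>n. if n = m then 0 else 1 / ((2 * real n + 1)\<^sup>2 - M\<^sup>2)) sums
      ((1 / (4 * M)) * (0 + 1 / M))" by (simp only:)
  also have "(1 / (4 * M)) * (0 + 1 / M) = 1 / (4 * M\<^sup>2)"
    by (simp add: power2_eq_square)
  finally show ?thesis unfolding M_def .
qed

text \<open>The two regions off the diagonal are parametrised by the smaller index and the gap
  \<open>Suc d\<close>. On each, the difference of squares is at least the squared gap in absolute
  value, so the product series \<open>B\<close> dominates. This justifies iterated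
  summation.\<close>

lemma summable_on_odd_square_kernel:
  assumes "s \<ge> 2"
  shows "(\<lambda>(m, n). if n = m then 0 else
            1 / (2 * real m + 1) ^ s * (1 / ((2 * real n + 1)\<^sup>2 - (2 * real m + 1)\<^sup>2)))
          summable_on (UNIV \<times> UNIV)" (is "?h summable_on _")
proof -
  define B where "B = (\<lambda>(m::nat, d::nat). 1 / (2 * real m + 1) ^ 2 * (1 / real (Suc d) ^ 2))"
  have s1: "((\<lambda>d. 1 / real (Suc d) ^ 2) has_sum (pi\<^sup>2 / 6)) UNIV"
    using sums_nonneg_imp_has_sum[OF inverse_squares_sums] by (simp add: add.commute)
  have s2: "(\<lambda>m. 1 / (2 * real m + 1) ^ 2 * (pi\<^sup>2 / 6)) summable_on UNIV"
    using lam_has_sum[of 2] by (intro summable_on_cmult_left) (auto simp: summable_on_def)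
  have B: "B summable_on UNIV \<times> UNIV"
  proof (rule summable_on_SigmaI[OF _ s2])
    show "((\<lambda>d. B (m, d)) has_sum (1 / (2 * real m + 1) ^ 2 * (pi\<^sup>2 / 6))) UNIV" for m
      unfolding B_def prod.case by (rule has_sum_cmult_right[OF s1])
  qed (simp add: B_def)
  have pow: "1 / (2 * real m + 1) ^ s \<le> 1 / (2 * real m + 1) ^ 2" for m
    using assms by (intro divide_left_mono power_increasing) auto
  have inverse_abs_le: "\<bar>1 / y\<bar> \<le> 1 / x" if "x \<le> y" "0 < x" for x y :: real
    using that by (simp add: frac_le)
  define U where "U = {(m, n). m < (n::nat)}"
  define V where "V = {(m, n). n < (m::nat)}"
  have "(\<lambda>x. ?h (case x of (m, d) \<Rightarrow> (m, m + Suc d))) summable_on UNIV \<times> UNIV"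
  proof (rule abs_summable_summable, rule Infinite_Sum.abs_summable_on_comparison_test'[OF B])
    fix x :: "nat \<times> nat"
    obtain m d where x: "x = (m, d)" by force
    have "real (Suc d) ^ 2 \<le> (2 * real (m + Suc d) + 1)\<^sup>2 - (2 * real m + 1)\<^sup>2"
      by (simp add: power2_eq_square algebra_simps)
    moreover have "real (Suc d) ^ 2 > 0" by simp
    ultimately have *: "\<bar>1 / ((2 * real (m + Suc d) + 1)\<^sup>2 - (2 * real m + 1)\<^sup>2)\<bar> \<le> 1 / real (Suc d) ^ 2"
      using inverse_abs_le by blast
    from mult_mono[OF pow[of m] *]
    show "norm (?h (case x of (m, d) \<Rightarrow> (m, m + Suc d))) \<le> B x"
      unfolding x B_def by (simp add: abs_mult del: of_nat_Suc of_nat_add)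
  qed
  then have U: "?h summable_on U"
    by (subst (asm) summable_on_reindex_bij_witness[where T = U and S = "UNIV \<times> UNIV"
          and j = "\<lambda>(m, d). (m, m + Suc d)" and i = "\<lambda>(m, n). (m, n - Suc m)" and h = ?h])
       (auto simp: U_def)
  have "(\<lambda>x. ?h (case x of (n, d) \<Rightarrow> (n + Suc d, n))) summable_on UNIV \<times> UNIV"
  proof (rule abs_summable_summable, rule Infinite_Sum.abs_summable_on_comparison_test'[OF B])
    fix x :: "nat \<times> nat"
    obtain n d where x: "x = (n, d)" by force
    have le: "real (Suc d) ^ 2 \<le> (2 * real (n + Suc d) + 1)\<^sup>2 - (2 * real n + 1)\<^sup>2"
      by (simp add: power2_eq_square algebra_simps)
    moreover have "real (Suc d) ^ 2 > 0" by simp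
    ultimately have "\<bar>1 / ((2 * real (n + Suc d) + 1)\<^sup>2 - (2 * real n + 1)\<^sup>2)\<bar> \<le> 1 / real (Suc d) ^ 2"
      using inverse_abs_le by blast
    then have *: "\<bar>1 / ((2 * real n + 1)\<^sup>2 - (2 * real (n + Suc d) + 1)\<^sup>2)\<bar> \<le> 1 / real (Suc d) ^ 2"
      by (metis abs_divide abs_minus_commute)
    have "1 / (2 * real (n + Suc d) + 1) ^ 2 \<le> 1 / (2 * real n + 1) ^ 2"
      by (intro divide_left_mono power_mono) auto
    with pow[of "n + Suc d"] have "1 / (2 * real (n + Suc d) + 1) ^ s \<le> 1 / (2 * real n + 1) ^ 2"
      by linarith
    from mult_mono[OF this *]
    show "norm (?h (case x of (n, d) \<Rightarrow> (n + Suc d, n))) \<le> B x"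
      unfolding x B_def by (simp add: abs_mult del: of_nat_Suc of_nat_add)
  qed
  then have V: "?h summable_on V"
    by (subst (asm) summable_on_reindex_bij_witness[where T = V and S = "UNIV \<times> UNIV"
          and j = "\<lambda>(n, d). (n + Suc d, n)" and i = "\<lambda>(m, n). (n, m - Suc n)" and h = ?h])
       (auto simp: V_def)
  have "?h summable_on (U \<union> V)"
    using U V by (rule summable_on_Un_disjoint) (auto simp: U_def V_def)
  then show ?thesis
    by (rule summable_on_cong_neutral[THEN iffD1, rotated -1]) (auto simp: U_def V_def)
qed

text \<open>Summation over \<open>n\<close> first leaves a quarter of the series for
  \<open>lam (s + 2)\<close>, by \<open>odd_square_diff_sums\<close>.\<close>

lemma odd_square_kernel_has_sum:
  assumes "s \<ge> 2"
  shows "((\<lambda>(m, n). if n = m then 0 else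
            1 / (2 * real m + 1) ^ s * (1 / ((2 * real n + 1)\<^sup>2 - (2 * real m + 1)\<^sup>2)))
          has_sum (lam (s + 2) / 4)) (UNIV \<times> UNIV)" (is "(?h has_sum _) _")
proof (rule has_sum_SigmaI)
  note summ = summable_on_odd_square_kernel[OF assms]
  show "?h summable_on (UNIV \<times> UNIV)" by (rule summ)
  have "((\<lambda>m. 1 / 4 * (1 / (2 * real m + 1) ^ (s + 2))) has_sum (1 / 4 * lam (s + 2))) UNIV"
    by (intro has_sum_cmult_right lam_has_sum) auto
  then show "((\<lambda>m. 1 / 4 * (1 / (2 * real m + 1) ^ (s + 2))) has_sum (lam (s + 2) / 4)) UNIV"
    by simp
  fix m :: nat
  have "(\<lambda>n. ?h (m, n)) summable_on UNIV"
    using summable_on_SigmaD1[where f = "\<lambda>m n. ?h (m, n)" and A = UNIV and B = "\<lambda>_. UNIV" and x = m] summ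
    by simp
  then obtain S where S: "((\<lambda>n. ?h (m, n)) has_sum S) UNIV"
    by (auto simp: summable_on_def)
  have "(\<lambda>n. 1 / (2 * real m + 1) ^ s *
      (if n = m then 0 else 1 / ((2 * real n + 1)\<^sup>2 - (2 * real m + 1)\<^sup>2)))
      sums (1 / (2 * real m + 1) ^ s * (1 / (4 * (2 * real m + 1)\<^sup>2)))"
    by (intro sums_mult odd_square_diff_sums)
  also have "(\<lambda>n. 1 / (2 * real m + 1) ^ s *
      (if n = m then 0 else 1 / ((2 * real n + 1)\<^sup>2 - (2 * real m + 1)\<^sup>2))) = (\<lambda>n. ?h (m, n))"
    by auto
  also have "1 / (2 * real m + 1) ^ s * (1 / (4 * (2 * real m + 1)\<^sup>2))
      = 1 / 4 * (1 / (2 * real m + 1) ^ (s + 2))"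
    by (simp add: power_add power2_eq_square mult_ac)
  finally have "S = 1 / 4 * (1 / (2 * real m + 1) ^ (s + 2))"
    using has_sum_imp_sums[OF S] sums_unique2 by blast
  with S show "((\<lambda>n. ?h (m, n)) has_sum (1 / 4 * (1 / (2 * real m + 1) ^ (s + 2)))) UNIV"
    by simp
qed

text \<open>A geometric sum with ratio \<open>y / x\<close>, written as two terms that are exchanged
  when \<open>x\<close> and \<open>y\<close> are. For \<open>k = 0\<close> both truncated exponents
  are 0 and the two terms cancel.\<close>

lemma geometric_convolution:
  fixes x y :: real
  assumes "x \<noteq> 0" "y \<noteq> 0" "x \<noteq> y"
  shows "(\<Sum>j = 1..<k. 1 / x ^ j * (1 / y ^ (k - j)))
       = 1 / x ^ (k - 1) * (1 / (y - x)) + 1 / y ^ (k - 1) * (1 / (x - y))"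
proof (cases k)
  case (Suc n)
  have "(\<Sum>j = 1..<Suc n. 1 / x ^ j * (1 / y ^ (Suc n - j)))
       = 1 / x ^ n * (1 / (y - x)) + 1 / y ^ n * (1 / (x - y))"
  proof (induction n)
    case 0
    then show ?case using assms by (simp add: divide_simps)
  next
    case (Suc n)
    have "(\<Sum>j = 1..<Suc (Suc n). 1 / x ^ j * (1 / y ^ (Suc (Suc n) - j)))
        = (\<Sum>j = 1..<Suc n. 1 / x ^ j * (1 / y ^ (Suc n - j))) / y + 1 / x ^ Suc n * (1 / y)"
      unfolding sum.atLeastLessThan_Suc[OF le_SucI[OF le_numeral_extra(4)]] sum_divide_distrib
      by (simp add: Suc_diff_le mult_ac)
    also have "\<dots> = 1 / x ^ Suc n * (1 / (y - x)) + 1 / y ^ Suc n * (1 / (x - y))"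
      unfolding Suc.IH using assms by (simp add: divide_simps) (simp add: algebra_simps)
    finally show ?case .
  qed
  then show ?thesis by (simp add: Suc)
next
  case 0
  then show ?thesis using assms by (simp add: divide_simps)
qed

text \<open>The analogue for odd integers of Euler's convolution identity for zeta at even
  arguments. The double sum \<open>f\<close> is evaluated twice: iterated summation gives the left
  side, while the diagonal contributes \<open>k - 1\<close> and each of the two off-diagonal terms
  \<open>1 / 4\<close> times \<open>lam (2 * k)\<close>.\<close>

lemma lam_convolution:
  assumes "k \<ge> 2"
  shows "(\<Sum>j = 1..<k. lam (2 * j) * lam (2 * (k - j))) = (real k - 1 / 2) * lam (2 * k)"
proof -
  define h where "h = (\<lambda>(m, n). if n = m then 0 else
            1 / (2 * real m + 1) ^ (2 * (k - 1)) * (1 / ((2 * real n + 1)\<^sup>2 - (2 * real m + 1)\<^sup>2)))"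
  define D where "D = (\<lambda>(m::nat, n::nat). if n = m then (real k - 1) * (1 / (2 * real m + 1) ^ (2 * k)) else 0)"
  define f where "f = (\<lambda>(m::nat, n::nat). \<Sum>j = 1..<k. 1 / (2 * real m + 1) ^ (2 * j) * (1 / (2 * real n + 1) ^ (2 * (k - j))))"
  have k2: "2 * (k - 1) + 2 = 2 * k" using assms by simp
  have h1: "(h has_sum (lam (2 * k) / 4)) (UNIV \<times> UNIV)"
    using odd_square_kernel_has_sum[of "2 * (k - 1)"] assms unfolding h_def k2 by simp
  then have h2: "((\<lambda>(m, n). h (n, m)) has_sum (lam (2 * k) / 4)) (UNIV \<times> UNIV)"
    by (rule has_sum_swap[THEN iffD1])
  have "((\<lambda>m. (real k - 1) * (1 / (2 * real m + 1) ^ (2 * k))) has_sum ((real k - 1) * lam (2 * k))) UNIV"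
    using assms by (intro has_sum_cmult_right lam_has_sum) auto
  then have "(D has_sum ((real k - 1) * lam (2 * k))) {(m, n). m = n}"
    by (subst (asm) has_sum_reindex_bij_witness[where T = "{(m, n). m = n}" and S = "UNIV"
          and j = "\<lambda>m. (m, m)" and i = "fst" and h = D]) (auto simp: D_def)
  then have D: "(D has_sum ((real k - 1) * lam (2 * k))) (UNIV \<times> UNIV)"
    by (rule has_sum_cong_neutral[THEN iffD1, rotated -1]) (auto simp: D_def)
  \<comment> \<open>Off the diagonal \<open>f\<close> is a finite geometric sum; the two resulting terms are swapped copies of \<open>h\<close>.\<close>
  have fhD: "f x = (case x of (m, n) \<Rightarrow> h (m, n) + h (n, m) + D (m, n))" for x
  proof -
    obtain m n where x: "x = (m, n)" by force
    show ?thesis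
    proof (cases "m = n")
      case True
      have "f (m, m) = (\<Sum>j = 1..<k. 1 / (2 * real m + 1) ^ (2 * k))"
        unfolding f_def prod.case by (intro sum.cong) (auto simp flip: power_add simp: algebra_simps)
      then show ?thesis using True assms by (simp add: x h_def D_def of_nat_diff)
    next
      case False
      have "f (m, n) = (\<Sum>j = 1..<k. 1 / ((2 * real m + 1)\<^sup>2) ^ j * (1 / ((2 * real n + 1)\<^sup>2) ^ (k - j)))"
        by (simp add: f_def power_mult)
      also have "\<dots> = h (m, n) + h (n, m)"
        using False by (subst geometric_convolution) (auto simp: h_def power_mult power2_eq_iff)
      finally show ?thesis using False by (simp add: x D_def)
    qed
  qed
  have "((\<lambda>x. (case x of (m, n) \<Rightarrow> h (m, n)) + (case x of (m, n) \<Rightarrow> h (n, m)) + D x) has_sum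
      (lam (2 * k) / 4 + lam (2 * k) / 4 + (real k - 1) * lam (2 * k))) (UNIV \<times> UNIV)"
    using h1 h2 D by (intro has_sum_add) auto
  then have f1: "(f has_sum ((real k - 1 / 2) * lam (2 * k))) (UNIV \<times> UNIV)"
    by (rule back_subst) (auto simp: fhD algebra_simps intro!: has_sum_cong)
  define g where "g = (\<lambda>m. \<Sum>j = 1..<k. 1 / (2 * real m + 1) ^ (2 * j) * lam (2 * (k - j)))"
  have "((\<lambda>n. f (m, n)) has_sum g m) UNIV" for m
    unfolding f_def g_def prod.case by (intro has_sum_sum has_sum_cmult_right lam_has_sum) auto
  with f1 have "(g has_sum ((real k - 1 / 2) * lam (2 * k))) UNIV"
    by (intro has_sum_SigmaD[OF f1]) auto
  moreover have "(g has_sum (\<Sum>j = 1..<k. lam (2 * j) * lam (2 * (k - j)))) UNIV"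
    unfolding g_def by (intro has_sum_sum has_sum_cmult_left lam_has_sum) auto
  ultimately show ?thesis
    using has_sum_unique by blast
qed

section \<open>Bernoulli numbers and Euler's formula\<close>

text \<open>The Taylor coefficients of \<open>tanh(t/2)/2 = 1/2 - 1/(e\<^sup>t + 1)\<close>.\<close>

definition tanh_coeff :: "nat \<Rightarrow> real" where
  "tanh_coeff n = (if n = 0 then 0 else (2 ^ (n + 1) - 1) * bernoulli (n + 1) / fact (n + 1))"

text \<open>For F(t) = t / (e^t - 1) the series on the left is F(2t) - F(t), and e^(2t) - 1 = (e^t -
  1)(e^t + 1) reduces it to -t / (e^t + 1).\<close>

lemma bernoulli_double_generating_function:
  "Abs_fps (\<lambda>n. (2 ^ n - 1) * bernoulli n / fact n) * (fps_exp 1 + 1) = - fps_X"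
proof -
  define F where "F = Abs_fps (\<lambda>n. bernoulli n / fact n)"
  define E where "E = fps_exp (1::real)"
  have 1: "F * (E - 1) = fps_X"
    unfolding F_def E_def by (rule bernoulli_generating_function)
  have "fps_compose (F * (E - 1)) (fps_const 2 * fps_X) = fps_compose fps_X (fps_const 2 * fps_X)"
    by (simp add: 1)
  then have "fps_compose F (fps_const 2 * fps_X) * (E ^ 2 - 1) = fps_const 2 * fps_X"
    by (simp add: fps_compose_mult_distrib fps_compose_sub_distrib E_def fps_exp_compose_linear
        fps_exp_power_mult)
  then have 2: "fps_compose F (fps_const 2 * fps_X) * (E ^ 2 - 1) = fps_const 2 * (F * (E - 1))"
    by (simp add: 1)
  define G where "G = Abs_fps (\<lambda>n. (2 ^ n - 1) * bernoulli n / fact n)"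
  have G: "G = fps_compose F (fps_const 2 * fps_X) - F"
    by (rule fps_ext, simp add: G_def F_def fps_compose_linear) (simp add: algebra_simps diff_divide_distrib)
  have c2: "fps_const (2::real) = 2" by (simp add: numeral_fps_const)
  \<comment> \<open>\<open>C\<close> stands for F(2t), which makes this a pure ring identity; the
    factor \<open>E - 1\<close> is cancelled afterwards.\<close>
  have "C * (E ^ 2 - 1) = 2 * (F * (E - 1)) \<Longrightarrow> F * (E - 1) = fps_X
      \<Longrightarrow> ((C - F) * (E + 1)) * (E - 1) = (- fps_X) * (E - 1)" for C :: "real fps"
    by algebra
  then have "(G * (E + 1)) * (E - 1) = (- fps_X) * (E - 1)"
    using 1 2 unfolding G c2 by blast
  moreover have "E - 1 \<noteq> 0" using 1 by auto
  ultimately have "G * (E + 1) = - fps_X" using mult_right_cancel by blast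
  then show ?thesis by (simp only: G_def E_def)
qed

text \<open>The series f = 1 / (e^t + 1) satisfies f' = f^2 - f, and passing to 1/2 - f completes
  the square. The resulting Riccati equation gives a quadratic recurrence for the
  coefficients.\<close>

lemma tanh_coeff_ode:
  "fps_deriv (Abs_fps tanh_coeff) = fps_const (1 / 4) - (Abs_fps tanh_coeff) ^ 2"
proof -
  define G where "G = Abs_fps (\<lambda>n. (2 ^ n - 1) * bernoulli n / fact n)"
  define f where "f = - fps_shift 1 G"
  define E where "E = fps_exp (1::real)"
  have "G = - (fps_X * f)"
    by (rule fps_ext) (auto simp: f_def G_def)
  moreover have "G * (E + 1) = - fps_X"
    unfolding G_def E_def by (rule bernoulli_double_generating_function)
  ultimately have "fps_X * (f * (E + 1)) = fps_X * 1" by (simp add: mult.assoc)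
  then have f: "f * (E + 1) = 1" by simp
  then have "fps_deriv (f * (E + 1)) = 0" by simp
  then have "fps_deriv f * (E + 1) + f * E = 0" by (simp add: E_def algebra_simps)
  with f have f': "fps_deriv f = f ^ 2 - f" by algebra
  \<comment> \<open>The constant term is computed separately because \<open>tanh_coeff 0\<close> is
    set to 0, which must agree with \<open>1 / 2\<close> minus the constant term of
    \<open>f\<close>.\<close>
  have "fps_nth (f * (E + 1)) 0 = 1" by (simp add: f)
  then have "fps_nth f 0 = 1 / 2" by (simp add: E_def)
  then have T: "Abs_fps tanh_coeff = fps_const (1 / 2) - f"
    by (intro fps_ext) (auto simp: tanh_coeff_def f_def G_def)
  define h where "h = fps_const (1 / 2 :: real)"
  have h4: "fps_const (1 / 4) = h ^ 2" by (simp add: h_def fps_const_power power2_eq_square)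
  have "2 * h = 1"
    by (simp add: h_def numeral_fps_const fps_const_mult)
  then have "- fps_deriv f = h ^ 2 - (h - f) ^ 2"
    using f' by algebra
  then show ?thesis
    unfolding T h4 by (simp add: h_def)
qed

lemma tanh_coeff_rec:
  "real (Suc n) * tanh_coeff (Suc n)
     = (if n = 0 then 1 / 4 else 0) - (\<Sum>i\<le>n. tanh_coeff i * tanh_coeff (n - i))"
  using arg_cong[OF tanh_coeff_ode, of "\<lambda>f. fps_nth f n"]
  by (simp add: power2_eq_square fps_mult_nth atLeast0AtMost)

text \<open>The function tanh is odd. In the recurrence for an even index \<open>Suc m\<close>, one
  of \<open>i\<close> and \<open>m - i\<close> is always even, so induction kills every
  product.\<close>

lemma tanh_coeff_even: "even n \<Longrightarrow> tanh_coeff n = 0"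
proof (induction n rule: less_induct)
  case (less n)
  show ?case
  proof (cases n)
    case 0
    then show ?thesis by (simp add: tanh_coeff_def)
  next
    case (Suc m)
    have "(\<Sum>i\<le>m. tanh_coeff i * tanh_coeff (m - i)) = 0"
    proof (rule sum.neutral, rule ballI)
      fix i assume "i \<in> {..m}"
      then show "tanh_coeff i * tanh_coeff (m - i) = 0"
        using less.IH[of i] less.IH[of "m - i"] less.prems Suc by (cases "even i") auto
    qed
    moreover have "m \<noteq> 0" using less.prems Suc by (cases m) auto
    ultimately show ?thesis using tanh_coeff_rec[of m] Suc by simp
  qed
qed

text \<open>Dropping the even indices brings the recurrence into the shape of
  \<open>lam_convolution\<close>, so that the two can be compared.\<close>

lemma tanh_coeff_odd_rec:
  assumes "k \<ge> 2"
  shows "real (2 * k - 1) * tanh_coeff (2 * k - 1)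
     = - (\<Sum>j = 1..<k. tanh_coeff (2 * j - 1) * tanh_coeff (2 * (k - j) - 1))"
proof -
  have "(\<Sum>i\<le>2 * k - 2. tanh_coeff i * tanh_coeff (2 * k - 2 - i))
      = (\<Sum>i\<in>(\<lambda>j. 2 * j - 1) ` {1..<k}. tanh_coeff i * tanh_coeff (2 * k - 2 - i))"
  proof (rule sum.mono_neutral_right)
    show "\<forall>i\<in>{..2 * k - 2} - (\<lambda>j. 2 * j - 1) ` {1..<k}. tanh_coeff i * tanh_coeff (2 * k - 2 - i) = 0"
    proof
      fix i assume i: "i \<in> {..2 * k - 2} - (\<lambda>j. 2 * j - 1) ` {1..<k}"
      have "even i"
      proof (rule ccontr)
        assume "odd i"
        then obtain j where "i = 2 * j + 1" by (auto elim: oddE)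
        with i have "i = 2 * (j + 1) - 1" "j + 1 \<in> {1..<k}" by auto
        with i show False by blast
      qed
      then show "tanh_coeff i * tanh_coeff (2 * k - 2 - i) = 0" by (simp add: tanh_coeff_even)
    qed
  qed auto
  also have "\<dots> = (\<Sum>j = 1..<k. tanh_coeff (2 * j - 1) * tanh_coeff (2 * k - 2 - (2 * j - 1)))"
    by (subst sum.reindex) (auto simp: inj_on_def)
  also have "\<dots> = (\<Sum>j = 1..<k. tanh_coeff (2 * j - 1) * tanh_coeff (2 * (k - j) - 1))"
    by (intro sum.cong refl arg_cong2[where f = "(*)"] arg_cong[where f = tanh_coeff]) auto
  finally show ?thesis
    using tanh_coeff_rec[of "2 * k - 2"] assms by (simp add: Suc_diff_Suc numeral_2_eq_2)
qed

section \<open>Zeta values through odd power sums, and Euler's formula\<close>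

lemma inverse_power_sums_lam:
  assumes "s \<ge> 2"
  shows "(\<lambda>n. 1 / real (Suc n) ^ s) sums (lam s * 2 ^ s / (2 ^ s - 1))"
proof -
  define f where "f = (\<lambda>n. 1 / real (Suc n) ^ s)"
  have "summable f"
    using inverse_power_summable[OF assms, where 'a = real]
    unfolding f_def by (subst (asm) summable_Suc_iff[symmetric]) (simp add: inverse_eq_divide del: of_nat_Suc)
  then obtain Z where Z: "f sums Z" by blast
  have "(\<lambda>n. sum f {n * 2..<n * 2 + 2}) sums Z"
    by (rule sums_group[OF Z]) simp
  moreover have "sum f {n * 2..<n * 2 + 2} = 1 / (2 * real n + 1) ^ s + 1 / 2 ^ s * f n" for n
  proof -
    have "{n * 2..<n * 2 + 2} = {2 * n, Suc (2 * n)}" by auto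
    moreover have "f (2 * n) = 1 / (2 * real n + 1) ^ s"
      by (simp add: f_def add.commute)
    moreover have "f (Suc (2 * n)) = 1 / 2 ^ s * f n"
    proof -
      have "real (Suc (Suc (2 * n))) = 2 * real (Suc n)" by simp
      then show ?thesis unfolding f_def by (simp only: power_mult_distrib) simp
    qed
    ultimately show ?thesis by simp
  qed
  ultimately have "(\<lambda>n. 1 / (2 * real n + 1) ^ s + 1 / 2 ^ s * f n) sums Z" by simp
  moreover have "(\<lambda>n. 1 / (2 * real n + 1) ^ s + 1 / 2 ^ s * f n) sums (lam s + 1 / 2 ^ s * Z)"
    by (intro sums_add sums_mult Z lam_sums assms)
  \<comment> \<open>The odd integers give \<open>lam s\<close>, and the even ones reproduce the
    whole series scaled by \<open>1 / 2 ^ s\<close>.\<close>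
  ultimately have eq: "Z = lam s + 1 / 2 ^ s * Z" by (rule sums_unique2)
  have "(1::real) < 2 ^ s" using assms by simp
  with eq have "Z = lam s * 2 ^ s / (2 ^ s - 1)"
    by (simp add: field_simps)
  with Z show ?thesis by (simp add: f_def)
qed

lemma lam_2: "lam 2 = pi\<^sup>2 / 8"
proof -
  have "lam 2 * 2 ^ 2 / (2 ^ 2 - 1) = pi\<^sup>2 / 6"
    using inverse_power_sums_lam[of 2] inverse_squares_sums
    by (intro sums_unique2[of "\<lambda>n. 1 / real (Suc n) ^ 2"]) (simp_all add: add.commute)
  then show ?thesis by simp
qed

text \<open>The factor \<open>2 ^ s - 1\<close> stays on the left because the zeta value enters
  \<open>Q\<close> multiplied by exactly this factor.\<close>

lemma zeta_eq_lam:
  assumes "s \<ge> 2"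
  shows "zeta (of_nat s) * (2 ^ s - 1) = of_real (2 ^ s * lam s)"
proof -
  have "(1::real) < 2 ^ s" using assms by simp
  have "(\<lambda>n. of_real (1 / real (Suc n) ^ s)) sums (of_real (lam s * 2 ^ s / (2 ^ s - 1)) :: complex)"
    using inverse_power_sums_lam[OF assms] by (simp only: sums_of_real_iff)
  also have "(\<lambda>n. of_real (1 / real (Suc n) ^ s)) = (\<lambda>n. 1 / of_nat (Suc n) powr (of_nat s :: complex))"
    by (intro ext, subst powr_nat) (auto simp del: of_nat_Suc)
  finally have "zeta (of_nat s) = of_real (lam s * 2 ^ s / (2 ^ s - 1))"
    unfolding zeta_def by (simp add: sums_iff)
  moreover have "(2 ^ s - 1 :: complex) = of_real (2 ^ s - 1)" by simp
  ultimately have "zeta (of_nat s) * (2 ^ s - 1) = of_real (lam s * 2 ^ s / (2 ^ s - 1) * (2 ^ s - 1))"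
    by (simp only: of_real_mult)
  also have "lam s * 2 ^ s / (2 ^ s - 1) * (2 ^ s - 1) = 2 ^ s * lam s"
    using \<open>1 < 2 ^ s\<close> by simp
  finally show ?thesis .
qed

text \<open>Euler's formula: by \<open>tanh_coeff_odd_rec\<close> and \<open>lam_convolution\<close>
  both sides obey the same recurrence, and the Basel value \<open>lam_2\<close> settles
  \<open>k = 1\<close>.\<close>

lemma tanh_coeff_eq_lam:
  assumes "k \<ge> 1"
  shows "tanh_coeff (2 * k - 1) = (-1) ^ (k + 1) * 2 * lam (2 * k) / pi ^ (2 * k)"
  using assms
proof (induction k rule: less_induct)
  case (less k)
  show ?case
  proof (cases "k = 1")
    case True
    have "tanh_coeff 1 = 1 / 4"
      using tanh_coeff_rec[of 0] tanh_coeff_even[of 0] by simp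
    then show ?thesis using True by (simp add: lam_2)
  next
    case False
    with less.prems have k: "k \<ge> 2" by simp
    have "real (2 * k - 1) * tanh_coeff (2 * k - 1)
        = - (\<Sum>j = 1..<k. tanh_coeff (2 * j - 1) * tanh_coeff (2 * (k - j) - 1))"
      by (rule tanh_coeff_odd_rec[OF k])
    also have "(\<Sum>j = 1..<k. tanh_coeff (2 * j - 1) * tanh_coeff (2 * (k - j) - 1))
        = (\<Sum>j = 1..<k. (-1) ^ k * 4 / pi ^ (2 * k) * (lam (2 * j) * lam (2 * (k - j))))"
    proof (rule sum.cong)
      fix j assume j: "j \<in> {1..<k}"
      define i where "i = k - j"
      have ij: "k = j + i" "i \<ge> 1" "i < k" using j by (auto simp: i_def)
      have "tanh_coeff (2 * j - 1) = (-1) ^ (j + 1) * 2 * lam (2 * j) / pi ^ (2 * j)"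
           "tanh_coeff (2 * i - 1) = (-1) ^ (i + 1) * 2 * lam (2 * i) / pi ^ (2 * i)"
        using less.IH j ij by auto
      then show "tanh_coeff (2 * j - 1) * tanh_coeff (2 * (k - j) - 1)
          = (-1) ^ k * 4 / pi ^ (2 * k) * (lam (2 * j) * lam (2 * (k - j)))"
        unfolding i_def[symmetric] ij(1) by (simp add: power_add distrib_left)
    qed simp
    also have "\<dots> = (-1) ^ k * 4 / pi ^ (2 * k) * ((real k - 1 / 2) * lam (2 * k))"
      by (simp only: sum_distrib_left[symmetric] lam_convolution[OF k])
    also have "- \<dots> = real (2 * k - 1) * ((-1) ^ (k + 1) * 2 * lam (2 * k) / pi ^ (2 * k))"
      using k by (simp add: of_nat_diff field_simps)
    finally have "real (2 * k - 1) * tanh_coeff (2 * k - 1)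
        = real (2 * k - 1) * ((-1) ^ (k + 1) * 2 * lam (2 * k) / pi ^ (2 * k))" .
    moreover have "real (2 * k - 1) \<noteq> 0" using k by simp
    ultimately show ?thesis using mult_left_cancel by blast
  qed
qed

lemma bernoulli_eq_lam:
  assumes "k \<ge> 1"
  shows "(2 ^ (2 * k) - 1) * bernoulli (2 * k) = (-1) ^ (k + 1) * 2 * fact (2 * k) * lam (2 * k) / pi ^ (2 * k)"
proof -
  have "tanh_coeff (2 * k - 1) = (2 ^ (2 * k) - 1) * bernoulli (2 * k) / fact (2 * k)"
    using assms by (simp add: tanh_coeff_def)
  then have "(2 ^ (2 * k) - 1) * bernoulli (2 * k) = tanh_coeff (2 * k - 1) * fact (2 * k)"
    by simp
  then show ?thesis
    unfolding tanh_coeff_eq_lam[OF assms] by (simp add: mult_ac)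
qed

section \<open>A special value and bounds for the lambda function\<close>

lemma lam_4: "lam 4 = pi ^ 4 / 96"
proof -
  have "{1..<2::nat} = {1}" by auto
  then show ?thesis
    using lam_convolution[of 2] by (simp add: lam_2 power2_eq_square power4_eq_xxxx)
qed

lemma lam_ge_1:
  assumes "s \<ge> 2"
  shows "lam s \<ge> 1"
  using sum_le_suminf[OF summable_inverse_odd_power[OF assms], of "{0}"] by (simp add: lam_def)

text \<open>After removal of the leading term 1 all bases are at least 3, so each unit added to the
  exponent divides every remaining term by at least 3.\<close>

lemma lam_le:
  assumes "s \<ge> t" "t \<ge> 2"
  shows "lam s - 1 \<le> (lam t - 1) / 3 ^ (s - t)"
proof -
  have tail: "(\<lambda>n. 1 / (2 * real (Suc n) + 1) ^ r) sums (lam r - 1)" if "r \<ge> 2" for r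
    using lam_sums[OF that] by (subst sums_Suc_iff) simp
  have "(\<lambda>n. 1 / (2 * real (Suc n) + 1) ^ t / 3 ^ (s - t)) sums ((lam t - 1) / 3 ^ (s - t))"
    using assms by (intro sums_divide tail)
  moreover have "(\<lambda>n. 1 / (2 * real (Suc n) + 1) ^ s) sums (lam s - 1)"
    using assms by (intro tail) auto
  moreover have "1 / (2 * real (Suc n) + 1) ^ s \<le> 1 / (2 * real (Suc n) + 1) ^ t / 3 ^ (s - t)" for n
  proof -
    have "(2 * real (Suc n) + 1) ^ s = (2 * real (Suc n) + 1) ^ t * (2 * real (Suc n) + 1) ^ (s - t)"
      using assms by (simp flip: power_add)
    moreover have "3 ^ (s - t) \<le> (2 * real (Suc n) + 1) ^ (s - t)"
      by (rule power_mono) auto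
    ultimately show ?thesis
      by (simp add: divide_simps del: of_nat_Suc)
  qed
  ultimately show ?thesis by (meson sums_le)
qed

section \<open>Self-inversive polynomials\<close>

text \<open>The bound for a Blaschke product, obtained root by root:
  \<open>norm (1 - r * cnj z)\<close> is at most \<open>norm (z - r)\<close> when
  \<open>norm r\<close> is at least 1 and \<open>norm z\<close> at most 1.\<close>

lemma norm_reflected_le:
  fixes p :: "complex poly"
  assumes "p \<noteq> 0" "\<And>r. poly p r = 0 \<Longrightarrow> norm r \<ge> 1" "z \<noteq> 0" "norm z \<le> 1"
  shows "norm z ^ degree p * norm (poly p (1 / cnj z)) \<le> norm (poly p z)"
  using assms(1,2)
proof (induction "degree p" arbitrary: p)
  case 0
  then obtain c where "p = [:c:]" by (metis degree_eq_zeroE)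
  then show ?case by simp
next
  case (Suc n)
  then have "\<not> constant (poly p)" by (simp add: constant_degree)
  then obtain r where r: "poly p r = 0" using fundamental_theorem_of_algebra by blast
  then obtain q where p: "p = [:-r, 1:] * q" by (auto simp: poly_eq_0_iff_dvd elim: dvdE)
  have q0: "q \<noteq> 0" using Suc.prems(1) p by auto
  have deg: "degree p = Suc (degree q)" unfolding p using q0 by (subst degree_mult_eq) auto
  have IH: "norm z ^ degree q * norm (poly q (1 / cnj z)) \<le> norm (poly q z)"
    using Suc.hyps Suc.prems(2) deg q0 by (intro Suc.hyps(1)) (auto simp: p)
  have r1: "norm r \<ge> 1" using Suc.prems(2) r by blast
  have "(norm (1 - r * cnj z))\<^sup>2 = (norm (z - r))\<^sup>2 - (1 - (norm z)\<^sup>2) * ((norm r)\<^sup>2 - 1)"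
    unfolding cmod_power2 by (simp add: power2_eq_square algebra_simps)
  moreover have "(1 - (norm z)\<^sup>2) * ((norm r)\<^sup>2 - 1) \<ge> 0"
    using r1 assms(4) by (intro mult_nonneg_nonneg) (auto simp: power_le_one)
  ultimately have "(norm (1 - r * cnj z))\<^sup>2 \<le> (norm (z - r))\<^sup>2" by linarith
  then have "norm (1 - r * cnj z) \<le> norm (z - r)"
    by (rule power2_le_imp_le) simp
  moreover have "norm z * norm (1 / cnj z - r) = norm (1 - r * cnj z)"
  proof -
    have "norm z * norm (1 / cnj z - r) = norm (cnj z * (1 / cnj z - r))"
      by (simp add: norm_mult)
    also have "cnj z * (1 / cnj z - r) = 1 - r * cnj z"
      using assms(3) by (simp add: algebra_simps)
    finally show ?thesis .
  qed
  ultimately have *: "norm z * norm (1 / cnj z - r) \<le> norm (z - r)" by simp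
  have "norm z ^ degree p * norm (poly p (1 / cnj z))
      = (norm z * norm (1 / cnj z - r)) * (norm z ^ degree q * norm (poly q (1 / cnj z)))"
    proof -
    have "poly p x = (x - r) * poly q x" for x by (simp add: p algebra_simps)
    then show ?thesis unfolding deg by (simp add: norm_mult)
  qed
  also have "\<dots> \<le> norm (z - r) * norm (poly q z)"
    by (intro mult_mono * IH) auto
  also have "\<dots> = norm (poly p z)" by (simp add: p flip: norm_mult) (simp add: algebra_simps)
  finally show ?case .
qed

text \<open>The logarithmic derivative is a sum of terms z / (z - r) over the roots r, and each has
  real part at most 1/2 when r lies outside the circle through z.\<close>

lemma Re_log_deriv_le:
  fixes p :: "complex poly"
  assumes "p \<noteq> 0" "\<And>r. poly p r = 0 \<Longrightarrow> norm r > 1" "norm z = 1"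
  shows "2 * Re (z * poly (pderiv p) z / poly p z) \<le> degree p"
  using assms(1,2)
proof (induction "degree p" arbitrary: p)
  case 0
  then obtain c where "p = [:c:]" by (metis degree_eq_zeroE)
  then show ?case by simp
next
  case (Suc n)
  then have "\<not> constant (poly p)" by (simp add: constant_degree)
  then obtain r where r: "poly p r = 0" using fundamental_theorem_of_algebra by blast
  then obtain q where p: "p = [:-r, 1:] * q" by (auto simp: poly_eq_0_iff_dvd elim: dvdE)
  have q0: "q \<noteq> 0" using Suc.prems(1) p by auto
  have deg: "degree p = Suc (degree q)" unfolding p using q0 by (subst degree_mult_eq) auto
  have IH: "2 * Re (z * poly (pderiv q) z / poly q z) \<le> degree q"
    using Suc.hyps Suc.prems(2) deg q0 by (intro Suc.hyps(1)) (auto simp: p)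
  have r1: "norm r > 1" using Suc.prems(2) r by blast
  then have zr: "z - r \<noteq> 0" using assms(3) by auto
  have qz: "poly q z \<noteq> 0" using Suc.prems(2)[of z] assms(3) by (auto simp: p)
  have "poly p z = (z - r) * poly q z" by (simp add: p algebra_simps)
  moreover have "poly (pderiv p) z = poly q z + (z - r) * poly (pderiv q) z"
    unfolding p pderiv_mult by (simp add: pderiv_pCons algebra_simps)
  ultimately have split: "z * poly (pderiv p) z / poly p z = z / (z - r) + z * poly (pderiv q) z / poly q z"
    using zr qz by (simp add: distrib_left add_divide_distrib)
  have "2 * Re (z / (z - r)) \<le> 1"
  proof -
    have "2 * Re (z * cnj (z - r)) = (norm (z - r))\<^sup>2 + (norm z)\<^sup>2 - (norm r)\<^sup>2"
      unfolding cmod_power2 by (simp add: power2_eq_square algebra_simps)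
    also have "\<dots> \<le> (norm (z - r))\<^sup>2" using assms(3) r1 by simp
    finally have "2 * Re (z * cnj (z - r)) / (norm (z - r))\<^sup>2 \<le> 1" using zr by simp
    then show ?thesis
      by (subst complex_div_cnj) (simp add: Re_divide_of_real flip: of_real_power)
  qed
  with IH show ?case unfolding split deg by simp
qed

text \<open>Inside the disc the equation forces \<open>norm (poly p w)\<close> to equal
  \<open>norm w ^ d * norm (poly p (1 / w))\<close>, whereas \<open>norm_reflected_le\<close> bounds
  it below with the smaller exponent \<open>degree p\<close>. Real coefficients allow
  \<open>1 / cnj w\<close> to be replaced by \<open>1 / w\<close>. The exterior follows by
  inversion.\<close>

lemma self_inversive_zeros:
  fixes p :: "complex poly" and \<epsilon> :: real
  assumes p0: "p \<noteq> 0" and out: "\<And>r. poly p r = 0 \<Longrightarrow> norm r > 1"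
    and coeffs: "\<And>n. coeff p n \<in> \<real>"
    and deg: "degree p < d" and eps: "\<epsilon> = 1 \<or> \<epsilon> = -1"
    and z: "z \<noteq> 0" "poly p z + of_real \<epsilon> * z ^ d * poly p (1 / z) = 0"
  shows "norm z = 1"
proof -
  have real: "poly p (cnj z) = cnj (poly p z)" for z
    using coeffs by (simp add: poly_cnj_real)
  have aux: False if w: "w \<noteq> 0" "norm w < 1" "poly p w + of_real \<epsilon> * w ^ d * poly p (1 / w) = 0" for w
  proof -
    have pw: "poly p w \<noteq> 0" using out[of w] w by auto
    have eq: "norm (poly p w) = norm w ^ d * norm (poly p (1 / w))"
    proof -
      have "poly p w = - (of_real \<epsilon> * w ^ d * poly p (1 / w))"
        using w(3) by (simp add: eq_neg_iff_add_eq_0)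
      then show ?thesis using eps by (auto simp: norm_mult norm_power)
    qed
    have "norm (poly p (1 / w)) = norm (poly p (1 / cnj w))"
      using real[of "1 / w"] by simp
    moreover have "norm w ^ degree p * norm (poly p (1 / cnj w)) \<le> norm (poly p w)"
      using norm_reflected_le[OF p0 _ w(1)] out w(2) by force
    ultimately have "norm w ^ degree p * norm (poly p (1 / w)) \<le> norm w ^ d * norm (poly p (1 / w))"
      using eq by simp
    moreover have "norm (poly p (1 / w)) > 0" using eq pw by auto
    moreover have "norm w ^ d < norm w ^ degree p"
      using w deg by (intro power_strict_decreasing) auto
    ultimately show False by simp
  qed
  have "norm z \<ge> 1" using aux[of z] z by force
  moreover have "norm z \<le> 1"
  proof (rule ccontr)
    assume "\<not> norm z \<le> 1"
    then have "norm (1 / z) < 1" by (simp add: norm_divide divide_simps)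
    \<comment> \<open>The equation is invariant under inversion because the square of
      \<open>\<epsilon>\<close> is 1.\<close>
    moreover have "poly p (1 / z) + of_real \<epsilon> * (1 / z) ^ d * poly p (1 / (1 / z)) = 0"
    proof -
      have "(of_real \<epsilon>)\<^sup>2 = (1::complex)" using eps by auto
      then have "poly p (1 / z) + of_real \<epsilon> * (1 / z) ^ d * poly p (1 / (1 / z))
          = of_real \<epsilon> * (1 / z) ^ d * (poly p z + of_real \<epsilon> * z ^ d * poly p (1 / z))"
        using z(1) by (simp add: field_simps power2_eq_square)
      then show ?thesis using z(2) by simp
    qed
    ultimately show False using aux[of "1 / z"] z(1) by simp
  qed
  ultimately show ?thesis by simp
qed

text \<open>At a multiple zero on the circle the equation and its derivative together give
  \<open>d = 2 * Re (z * p' / p)\<close>, which contradicts \<open>Re_log_deriv_le\<close> as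
  \<open>degree p < d\<close>. The derivative is an arbitrary \<open>D\<close> so that it can be
  transferred from a function that agrees with this one only near \<open>z\<close>.\<close>

lemma self_inversive_simple:
  fixes p :: "complex poly" and \<epsilon> :: real
  assumes p0: "p \<noteq> 0" and out: "\<And>r. poly p r = 0 \<Longrightarrow> norm r > 1"
    and coeffs: "\<And>n. coeff p n \<in> \<real>"
    and deg: "degree p < d" and eps: "\<epsilon> = 1 \<or> \<epsilon> = -1"
    and z: "z \<noteq> 0" "poly p z + of_real \<epsilon> * z ^ d * poly p (1 / z) = 0"
    and D: "((\<lambda>z. poly p z + of_real \<epsilon> * z ^ d * poly p (1 / z)) has_field_derivative D) (at z)"
  shows "D \<noteq> 0"
proof
  assume "D = 0"
  have z1: "norm z = 1" using self_inversive_zeros[OF p0 out coeffs deg eps z] by simp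
  have pz: "poly p z \<noteq> 0" using out[of z] z1 by auto
  have real: "poly p (cnj z) = cnj (poly p z)"
    using coeffs by (simp add: poly_cnj_real)
  have real': "poly (pderiv p) (cnj z) = cnj (poly (pderiv p) z)"
    using coeffs by (simp add: poly_cnj_real coeff_pderiv)
  have inv: "1 / z = cnj z"
    using z1 z(1) by (simp add: field_simps flip: complex_norm_square)
  have "((\<lambda>z. poly p z + of_real \<epsilon> * z ^ d * poly p (1 / z)) has_field_derivative
      (poly (pderiv p) z + (of_real \<epsilon> * (of_nat d * z ^ (d - 1)) * poly p (1 / z)
        + of_real \<epsilon> * z ^ d * (poly (pderiv p) (1 / z) * (- 1 / z\<^sup>2))))) (at z)"
    using z(1) by (auto intro!: derivative_eq_intros simp: power2_eq_square field_simps)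
  from DERIV_unique[OF D this] have "0 = poly (pderiv p) z + (of_real \<epsilon> * (of_nat d * z ^ (d - 1)) * poly p (1 / z)
        + of_real \<epsilon> * z ^ d * (poly (pderiv p) (1 / z) * (- 1 / z\<^sup>2)))" by (simp add: \<open>D = 0\<close>)
  then have "0 = z * (poly (pderiv p) z + (of_real \<epsilon> * (of_nat d * z ^ (d - 1)) * poly p (1 / z)
        + of_real \<epsilon> * z ^ d * (poly (pderiv p) (1 / z) * (- 1 / z\<^sup>2))))" by simp
  also have "\<dots> = z * poly (pderiv p) z + of_real \<epsilon> * z ^ d * (of_nat d * poly p (1 / z) - (1 / z) * poly (pderiv p) (1 / z))"
    using z(1) deg by (simp add: field_simps power2_eq_square flip: power_Suc)
  finally have "0 = z * poly (pderiv p) z + of_real \<epsilon> * z ^ d * (of_nat d * cnj (poly p z) - cnj (z * poly (pderiv p) z))"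
    unfolding inv real real' by simp
  \<comment> \<open>The equation for the zero itself serves to eliminate the factor with
    \<open>z ^ d\<close> from the derivative condition.\<close>
  moreover have "of_real \<epsilon> * z ^ d * cnj (poly p z) = - poly p z"
    using z(2) unfolding inv real by (simp add: eq_neg_iff_add_eq_0 add.commute)
  moreover have "of_real \<epsilon> * z ^ d * (of_nat d * cnj (poly p z) - cnj (z * poly (pderiv p) z))
      = of_real \<epsilon> * z ^ d * cnj (poly p z) * (of_nat d - cnj (z * poly (pderiv p) z / poly p z))"
    using pz by (simp add: algebra_simps)
  ultimately have "0 = z * poly (pderiv p) z - poly p z * (of_nat d - cnj (z * poly (pderiv p) z / poly p z))"
    by simp
  then have "of_nat d = z * poly (pderiv p) z / poly p z + cnj (z * poly (pderiv p) z / poly p z)"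
    using pz by (simp add: field_simps)
  then have "real d = 2 * Re (z * poly (pderiv p) z / poly p z)"
    by (smt (verit) Re_complex_of_real complex_add_cnj of_real_of_nat_eq)
  also have "\<dots> \<le> degree p" by (rule Re_log_deriv_le[OF p0 out z1])
  finally show False using deg by simp
qed

section \<open>Reduction of \<open>Q\<close>\<close>

lemma poly_P:
  "poly (P k) z = of_real ((2 * pi) ^ (2 * k - 1) / fact (2 * k)) *
      (\<Sum>j = 0..k. of_real ((-1) ^ j * bernoulli (2 * j) * bernoulli (2 * k - 2 * j)
          * of_nat ((2 * k) choose (2 * j))) * z ^ (2 * j))
     + zeta (2 * of_nat k - 1) * (z ^ (2 * k - 1) + (-1) ^ k * z)"
  by (simp add: P_def poly_sum poly_monom)

text \<open>The coefficient of \<open>z ^ (2 * j)\<close> is multiplied by 2^(2k) + 1 - 2^(2k-2j) -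
  2^(2j), which factors; the two odd powers of z acquire the same factor 2^(2k-1) - 1.\<close>

lemma poly_Q:
  assumes "k \<ge> 1"
  shows "poly (Q k) z =
            of_real ((2 * pi) ^ (2 * k - 1) / fact (2 * k))
              * (\<Sum>j = 0..k. of_real ((-1) ^ j * bernoulli (2 * j) * bernoulli (2 * k - 2 * j)
                   * (2 ^ (2 * j) - 1) * (2 ^ (2 * k - 2 * j) - 1)
                   * of_nat ((2 * k) choose (2 * j))) * z ^ (2 * j))
            + zeta (2 * of_nat k - 1) * (2 ^ (2 * k - 1) - 1)
              * ((-1) ^ k * z + z ^ (2 * k - 1))"
proof -
  define C where "C = (of_real ((2 * pi) ^ (2 * k - 1) / fact (2 * k)) :: complex)"
  define Z where "Z = zeta (2 * of_nat k - 1)"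
  define c where "c = (\<lambda>j. (-1) ^ j * bernoulli (2 * j) * bernoulli (2 * k - 2 * j)
          * of_nat ((2 * k) choose (2 * j)))"
  have P: "poly (P k) z = C * (\<Sum>j = 0..k. of_real (c j) * z ^ (2 * j)) + Z * (z ^ (2 * k - 1) + (-1) ^ k * z)" for z
    unfolding poly_P C_def Z_def c_def ..
  have Q: "poly (Q k) z = (2 ^ (2 * k) + 1) * poly (P k) z - 2 ^ (2 * k) * poly (P k) (z / 2) - poly (P k) (2 * z)"
    by (simp add: Q_def poly_pcompose mult.commute)
  have S: "(2 ^ (2 * k) + 1) * (\<Sum>j = 0..k. of_real (c j) * z ^ (2 * j))
      - 2 ^ (2 * k) * (\<Sum>j = 0..k. of_real (c j) * (z / 2) ^ (2 * j)) - (\<Sum>j = 0..k. of_real (c j) * (2 * z) ^ (2 * j))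
      = (\<Sum>j = 0..k. of_real (c j * ((2 ^ (2 * j) - 1) * (2 ^ (2 * k - 2 * j) - 1))) * z ^ (2 * j))"
    unfolding sum_distrib_left sum_subtractf[symmetric]
  proof (rule sum.cong)
    fix j assume "j \<in> {0..k}"
    then have k: "2 * k = 2 * j + (2 * k - 2 * j)" by simp
    have "(2::complex) ^ (2 * k) = 2 ^ (2 * j) * 2 ^ (2 * k - 2 * j)"
      by (subst k) (rule power_add)
    then show "(2 ^ (2 * k) + 1) * (of_real (c j) * z ^ (2 * j)) - 2 ^ (2 * k) * (of_real (c j) * (z / 2) ^ (2 * j))
        - of_real (c j) * (2 * z) ^ (2 * j)
        = of_real (c j * ((2 ^ (2 * j) - 1) * (2 ^ (2 * k - 2 * j) - 1))) * z ^ (2 * j)"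
      by (simp add: power_divide power_mult_distrib algebra_simps)
  qed simp
  have two: "(2::complex) ^ (2 * k) = 2 * 2 ^ (2 * k - 1)"
    using assms by (simp flip: power_Suc)
  have Z: "(2 ^ (2 * k) + 1) * (z ^ (2 * k - 1) + (-1) ^ k * z)
      - 2 ^ (2 * k) * ((z / 2) ^ (2 * k - 1) + (-1) ^ k * (z / 2)) - ((2 * z) ^ (2 * k - 1) + (-1) ^ k * (2 * z))
      = (2 ^ (2 * k - 1) - 1) * ((-1) ^ k * z + z ^ (2 * k - 1))"
    unfolding two by (simp add: power_divide power_mult_distrib algebra_simps)
  have "poly (Q k) z = C * ((2 ^ (2 * k) + 1) * (\<Sum>j = 0..k. of_real (c j) * z ^ (2 * j))
      - 2 ^ (2 * k) * (\<Sum>j = 0..k. of_real (c j) * (z / 2) ^ (2 * j)) - (\<Sum>j = 0..k. of_real (c j) * (2 * z) ^ (2 * j)))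
      + Z * ((2 ^ (2 * k) + 1) * (z ^ (2 * k - 1) + (-1) ^ k * z)
      - 2 ^ (2 * k) * ((z / 2) ^ (2 * k - 1) + (-1) ^ k * (z / 2)) - ((2 * z) ^ (2 * k - 1) + (-1) ^ k * (2 * z)))"
    unfolding Q P by (simp only: right_diff_distrib distrib_left mult_ac) (simp add: algebra_simps)
  also have "\<dots> = C * (\<Sum>j = 0..k. of_real (c j * ((2 ^ (2 * j) - 1) * (2 ^ (2 * k - 2 * j) - 1))) * z ^ (2 * j))
      + Z * (2 ^ (2 * k - 1) - 1) * ((-1) ^ k * z + z ^ (2 * k - 1))"
    unfolding S Z by (simp only: mult.assoc)
  finally show ?thesis
    unfolding C_def Z_def c_def by (simp only: mult_ac)
qed

text \<open>The zeros at \<open>j = 0\<close> and \<open>j \<ge> k\<close> are boundary values that make \<open>half_coeff\<close> below uniform in \<open>j\<close>.\<close>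

definition conv_coeff :: "nat \<Rightarrow> nat \<Rightarrow> real" where
  "conv_coeff k j = (if j = 0 \<or> j \<ge> k then 0 else lam (2 * j) * lam (2 * (k - j)))"

lemma conv_coeff_symmetric: "j \<le> k \<Longrightarrow> conv_coeff k (k - j) = conv_coeff k j"
  by (auto simp: conv_coeff_def)

text \<open>The polynomial A of the introductory sketch.\<close>

definition reduced_poly :: "nat \<Rightarrow> complex poly" where
  "reduced_poly k = monom (of_real (lam (2 * k - 1))) 0 + monom (of_real ((-1) ^ k * lam (2 * k - 1))) (2 * k - 2)
     + (\<Sum>j = 1..<k. monom (of_real (4 / pi * ((-1) ^ j * conv_coeff k j))) (2 * j - 1))"

lemma poly_reduced_poly:
  "poly (reduced_poly k) z = of_real (lam (2 * k - 1)) * (1 + (-1) ^ k * z ^ (2 * k - 2))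
     + of_real (4 / pi) * (\<Sum>j = 1..<k. of_real ((-1) ^ j * conv_coeff k j) * z ^ (2 * j - 1))"
  unfolding reduced_poly_def poly_add poly_sum poly_monom sum_distrib_left of_real_mult
  by (simp add: algebra_simps)

text \<open>Euler's formula for both Bernoulli numbers cancels the factorials against the binomial
  coefficient and leaves a single power of \<open>pi\<close> in the denominator.\<close>

lemma bernoulli_product_eq:
  assumes "1 \<le> j" "j < k"
  shows "(2 * pi) ^ (2 * k - 1) / fact (2 * k) *
      ((-1) ^ j * bernoulli (2 * j) * bernoulli (2 * k - 2 * j)
                   * (2 ^ (2 * j) - 1) * (2 ^ (2 * k - 2 * j) - 1) * of_nat ((2 * k) choose (2 * j)))
    = 2 ^ (2 * k - 1) * (-1) ^ k * (4 / pi * ((-1) ^ j * conv_coeff k j))"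
proof -
  define i where "i = k - j"
  have k: "k = j + i" "i \<ge> 1" using assms by (auto simp: i_def)
  have 1: "(2 ^ (2 * j) - 1) * bernoulli (2 * j) = (-1) ^ (j + 1) * 2 * fact (2 * j) * lam (2 * j) / pi ^ (2 * j)"
    using assms by (intro bernoulli_eq_lam)
  have 2: "(2 ^ (2 * i) - 1) * bernoulli (2 * i) = (-1) ^ (i + 1) * 2 * fact (2 * i) * lam (2 * i) / pi ^ (2 * i)"
    using k by (intro bernoulli_eq_lam)
  have 3: "real ((2 * k) choose (2 * j)) = fact (2 * k) / (fact (2 * j) * fact (2 * i))"
    using binomial_fact[of "2 * j" "2 * k", where 'a = real] assms by (simp add: i_def diff_mult_distrib2)
  have i2: "2 * k - 2 * j = 2 * i" by (simp add: i_def)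
  have "(2 * pi) ^ (2 * k - 1) / fact (2 * k) *
      ((-1) ^ j * bernoulli (2 * j) * bernoulli (2 * k - 2 * j)
                   * (2 ^ (2 * j) - 1) * (2 ^ (2 * k - 2 * j) - 1) * of_nat ((2 * k) choose (2 * j)))
    = (2 * pi) ^ (2 * k - 1) / fact (2 * k) * ((-1) ^ j * ((2 ^ (2 * j) - 1) * bernoulli (2 * j))
        * ((2 ^ (2 * i) - 1) * bernoulli (2 * i)) * (fact (2 * k) / (fact (2 * j) * fact (2 * i))))"
    unfolding i2 3 by (simp only: mult_ac)
  also have "\<dots> = (2 * pi) ^ (2 * k - 1) * ((-1) ^ j * (-1) ^ k * (-1) ^ j * 4 * (lam (2 * j) * lam (2 * i)) * (1 / pi ^ (2 * k)))
      * (-1) ^ j"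
    unfolding 1 2 k(1) by (simp add: power_add distrib_left)
  also have "\<dots> = 2 ^ (2 * k - 1) * (-1) ^ k * (4 / pi * ((-1) ^ j * conv_coeff k j))"
  proof -
    have "(2 * pi) ^ (2 * k - 1) = 2 ^ (2 * k - 1) * (pi ^ (2 * k) / pi)"
      using assms power_Suc[of pi "2 * k - 1"] by (simp add: power_mult_distrib)
    moreover have "conv_coeff k j = lam (2 * j) * lam (2 * i)"
      using assms by (simp add: conv_coeff_def i_def)
    ultimately show ?thesis by (simp add: field_simps)
  qed
  finally show ?thesis .
qed

lemma Q_eq_reduced_poly:
  assumes "k \<ge> 2"
  shows "Q k = smult (of_real (2 ^ (2 * k - 1) * (-1) ^ k)) ([:0, 1:] * reduced_poly k)"
proof -
  have k1: "k \<ge> 1" using assms by simp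
  define K where "K = 2 ^ (2 * k - 1) * (-1 :: real) ^ k"
  have "poly (Q k) z = poly (smult (of_real K) ([:0, 1:] * reduced_poly k)) z" for z
  proof -
    define t where "t = (\<lambda>j. (-1) ^ j * bernoulli (2 * j) * bernoulli (2 * k - 2 * j)
                   * (2 ^ (2 * j) - 1) * (2 ^ (2 * k - 2 * j) - 1)
                   * of_nat ((2 * k) choose (2 * j)) :: real)"
    \<comment> \<open>The end terms \<open>j = 0\<close> and \<open>j = k\<close> vanish, each
      containing a factor \<open>2 ^ 0 - 1\<close>.\<close>
    have "(\<Sum>j = 0..k. of_real (t j) * z ^ (2 * j)) = (\<Sum>j = 1..<k. of_real (t j) * z ^ (2 * j))"
      by (rule sum.mono_neutral_right) (auto simp: t_def not_less le_Suc_eq not_le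
            dest!: antisym[of k])
    then have "of_real ((2 * pi) ^ (2 * k - 1) / fact (2 * k)) * (\<Sum>j = 0..k. of_real (t j) * z ^ (2 * j))
        = (\<Sum>j = 1..<k. of_real ((2 * pi) ^ (2 * k - 1) / fact (2 * k) * t j) * z ^ (2 * j))"
      by (simp only: sum_distrib_left of_real_mult mult.assoc)
    also have "\<dots> = (\<Sum>j = 1..<k. of_real (K * (4 / pi * ((-1) ^ j * conv_coeff k j))) * z ^ (2 * j))"
      using bernoulli_product_eq by (intro sum.cong refl) (auto simp: t_def K_def)
    also have "\<dots> = of_real K * (z * (of_real (4 / pi) * (\<Sum>j = 1..<k. of_real ((-1) ^ j * conv_coeff k j) * z ^ (2 * j - 1))))"
      unfolding sum_distrib_left
    proof (rule sum.cong)
      fix j assume "j \<in> {1..<k}"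
      then have "z ^ (2 * j) = z * z ^ (2 * j - 1)" by (simp flip: power_Suc)
      then show "of_real (K * (4 / pi * ((-1) ^ j * conv_coeff k j))) * z ^ (2 * j)
          = of_real K * (z * (of_real (4 / pi) * (of_real ((-1) ^ j * conv_coeff k j) * z ^ (2 * j - 1))))"
        by simp
    qed simp
    finally have 1: "of_real ((2 * pi) ^ (2 * k - 1) / fact (2 * k)) * (\<Sum>j = 0..k. of_real (t j) * z ^ (2 * j))
        = of_real K * (z * (of_real (4 / pi) * (\<Sum>j = 1..<k. of_real ((-1) ^ j * conv_coeff k j) * z ^ (2 * j - 1))))" .
    have "(2 * of_nat k - 1 :: complex) = of_nat (2 * k - 1)"
      using assms by (simp add: of_nat_diff)
    then have "zeta (2 * of_nat k - 1) * (2 ^ (2 * k - 1) - 1) = of_real (2 ^ (2 * k - 1) * lam (2 * k - 1))"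
      using zeta_eq_lam[of "2 * k - 1"] assms by simp
    moreover have "z ^ (2 * k - 1) = z * z ^ (2 * k - 2)"
      using assms by (simp flip: power_Suc add: Suc_diff_Suc numeral_2_eq_2)
    moreover have "(-1 :: complex) ^ k * (-1) ^ k = 1" by (simp flip: power_mult_distrib)
    ultimately have 2: "zeta (2 * of_nat k - 1) * (2 ^ (2 * k - 1) - 1) * ((-1) ^ k * z + z ^ (2 * k - 1))
        = of_real K * (z * (of_real (lam (2 * k - 1)) * (1 + (-1) ^ k * z ^ (2 * k - 2))))"
      by (simp add: K_def algebra_simps)
    show ?thesis
      unfolding poly_Q[OF k1] 2 1[unfolded t_def] by (simp add: poly_reduced_poly algebra_simps)
  qed
  then show ?thesis unfolding K_def by (subst poly_eq_poly_eq_iff[symmetric]) auto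
qed

section \<open>Multiplication by 1 + z^2 and the self-inversive form\<close>

definition half_coeff :: "nat \<Rightarrow> nat \<Rightarrow> real" where
  "half_coeff k j = (-1) ^ j * (conv_coeff k j - conv_coeff k (Suc j))"

text \<open>The polynomial p of the introductory sketch: the lower half of (1 + z^2) A(z), whose
  reflection supplies the upper half.\<close>

definition half_poly :: "nat \<Rightarrow> complex poly" where
  "half_poly k = [:of_real (lam (2 * k - 1)), 0, of_real (lam (2 * k - 1)):]
     + (\<Sum>j < k div 2. monom (of_real (4 / pi * half_coeff k j)) (2 * j + 1))"

lemma poly_half_poly:
  "poly (half_poly k) z = of_real (lam (2 * k - 1)) * (1 + z\<^sup>2)
     + of_real (4 / pi) * (\<Sum>j < k div 2. of_real (half_coeff k j) * z ^ (2 * j + 1))"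
  unfolding half_poly_def poly_add poly_sum poly_monom sum_distrib_left of_real_mult
  by (simp add: algebra_simps power2_eq_square)

lemma half_poly_coeff_real: "coeff (half_poly k) n \<in> \<real>"
  unfolding half_poly_def coeff_add coeff_sum coeff_monom
  by (intro Reals_add sum_in_Reals) (auto simp: coeff_pCons split: nat.split)

lemma degree_half_poly:
  assumes "k \<ge> 2"
  shows "degree (half_poly k) < 2 * k"
proof -
  have "degree (half_poly k) \<le> 2 * k - 1"
    unfolding half_poly_def using assms
    by (intro degree_add_le degree_sum_le) (auto intro!: order_trans[OF degree_monom_le] order_trans[OF degree_pCons_le])
  then show ?thesis using assms by linarith
qed

text \<open>Reflection exchanges the two terms of the difference; the sign this costs changes the
  parity of \<open>k - 1\<close> into that of \<open>k\<close>.\<close>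

lemma half_coeff_symmetric:
  assumes "j < k"
  shows "half_coeff k (k - 1 - j) = (-1) ^ k * half_coeff k j"
proof -
  have "Suc (k - 1 - j) = k - j" "k - 1 - j = k - Suc j" using assms by auto
  then have 1: "half_coeff k (k - 1 - j) = (-1) ^ (k - Suc j) * (conv_coeff k (k - Suc j) - conv_coeff k (k - j))"
    by (simp add: half_coeff_def)
  have "(-1::real) ^ k = (-1) ^ (k - Suc j) * (-1) ^ Suc j"
    using assms by (metis Suc_leI le_add_diff_inverse2 power_add)
  then have "(-1::real) ^ (k - Suc j) = - ((-1) ^ k * (-1) ^ j)" by simp
  then show ?thesis
    unfolding 1 using assms by (simp add: conv_coeff_symmetric half_coeff_def algebra_simps)
qed

text \<open>For odd \<open>k\<close> the index \<open>k div 2\<close> is fixed by the reflection and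
  belongs to neither half, hence the hypothesis.\<close>

lemma sum_symmetric_halves:
  fixes f :: "nat \<Rightarrow> 'a :: comm_monoid_add"
  assumes "odd k \<Longrightarrow> f (k div 2) = 0"
  shows "(\<Sum>j<k. f j) = (\<Sum>j < k div 2. f j) + (\<Sum>j < k div 2. f (k - 1 - j))"
proof -
  have "(\<Sum>j<k. f j) = (\<Sum>j < k div 2. f j) + (\<Sum>j \<in> {k div 2..<k}. f j)"
    by (subst sum.union_disjoint[symmetric]) (auto intro!: sum.cong)
  also have "(\<Sum>j \<in> {k div 2..<k}. f j) = (\<Sum>j \<in> {k - k div 2..<k}. f j)"
  proof (rule sum.mono_neutral_right)
    show "\<forall>i\<in>{k div 2..<k} - {k - k div 2..<k}. f i = 0"
    proof
      fix i assume i: "i \<in> {k div 2..<k} - {k - k div 2..<k}"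
      then have "k div 2 \<le> i" "i < k - k div 2" by auto
      then have "i = k div 2" "odd k" by presburger+
      with assms show "f i = 0" by simp
    qed
  qed auto
  also have "\<dots> = (\<Sum>j < k div 2. f (k - 1 - j))"
    by (rule sum.reindex_bij_witness[of _ "\<lambda>j. k - 1 - j" "\<lambda>j. k - 1 - j"]) auto
  finally show ?thesis .
qed

lemma half_coeff_middle:
  assumes "odd k"
  shows "half_coeff k (k div 2) = 0"
proof -
  have "k - 1 - k div 2 = k div 2" "k div 2 < k" using assms by (auto elim!: oddE)
  with half_coeff_symmetric[of "k div 2" k] assms show ?thesis by simp
qed

text \<open>The factor 1 + z^2 adds neighbouring coefficients, which alternate in sign, so
  differences of \<open>conv_coeff\<close> appear. Its boundary zeros let both shifted sums run over
  \<open>j < k\<close>.\<close>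

lemma telescoped_conv_sum:
  fixes z :: complex
  assumes "k \<ge> 2"
  shows "(1 + z\<^sup>2) * (\<Sum>j = 1..<k. of_real ((-1) ^ j * conv_coeff k j) * z ^ (2 * j - 1))
       = (\<Sum>j<k. of_real (half_coeff k j) * z ^ (2 * j + 1))"
proof -
  define c where "c = (\<lambda>j. of_real ((-1) ^ j * conv_coeff k j) :: complex)"
  have c0: "c 0 = 0" "c k = 0" by (auto simp: c_def conv_coeff_def)
  have "(\<Sum>j = 1..<k. c j * z ^ (2 * j - 1)) = (\<Sum>j<k. c (Suc j) * z ^ (2 * j + 1))"
  proof -
    obtain m where m: "k = Suc m" using assms by (cases k) auto
    have "(\<Sum>j = 1..<k. c j * z ^ (2 * j - 1)) = (\<Sum>j<m. c (Suc j) * z ^ (2 * Suc j - 1))"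
      unfolding m One_nat_def sum.shift_bounds_Suc_ivl by (simp add: atLeast0LessThan)
    also have "\<dots> = (\<Sum>j<k. c (Suc j) * z ^ (2 * j + 1))"
      using c0 by (simp add: m)
    finally show ?thesis .
  qed
  moreover have "z\<^sup>2 * (\<Sum>j = 1..<k. c j * z ^ (2 * j - 1)) = (\<Sum>j<k. c j * z ^ (2 * j + 1))"
  proof -
    have "z\<^sup>2 * (\<Sum>j = 1..<k. c j * z ^ (2 * j - 1)) = (\<Sum>j = 1..<k. c j * z ^ (2 * j + 1))"
      unfolding sum_distrib_left
      by (intro sum.cong refl) (auto simp: power2_eq_square simp flip: power_Suc)
    also have "\<dots> = (\<Sum>j<k. c j * z ^ (2 * j + 1))"
      by (rule sum.mono_neutral_left) (auto simp: c0 not_le)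
    finally show ?thesis .
  qed
  ultimately have "(1 + z\<^sup>2) * (\<Sum>j = 1..<k. c j * z ^ (2 * j - 1))
      = (\<Sum>j<k. (c j + c (Suc j)) * z ^ (2 * j + 1))"
    by (simp add: distrib_right sum.distrib)
  moreover have "c j + c (Suc j) = of_real (half_coeff k j)" for j
    by (simp add: c_def half_coeff_def algebra_simps)
  ultimately show ?thesis by (simp add: c_def)
qed

text \<open>Coefficients at \<open>j\<close> and \<open>k - 1 - j\<close> agree up to
  \<open>(-1) ^ k\<close>, so the upper half of the odd powers reflects the lower half; the two
  terms with \<open>lam (2 * k - 1)\<close> split in the same way.\<close>

lemma reduced_poly_self_inversive:
  assumes "k \<ge> 2" "z \<noteq> 0"
  shows "poly ([:1, 0, 1:] * reduced_poly k) z
       = poly (half_poly k) z + of_real ((-1) ^ k) * z ^ (2 * k) * poly (half_poly k) (1 / z)"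
proof -
  define h where "h = (\<lambda>j. of_real (half_coeff k j) * z ^ (2 * j + 1))"
  have "h (k - 1 - j) = of_real ((-1) ^ k) * z ^ (2 * k) * (of_real (half_coeff k j) * (1 / z) ^ (2 * j + 1))"
    if "j < k div 2" for j
  proof -
    have "2 * k = (2 * (k - 1 - j) + 1) + (2 * j + 1)" using that by auto
    then have "z ^ (2 * k) = z ^ (2 * (k - 1 - j) + 1) * z ^ (2 * j + 1)" by (metis power_add)
    then have "z ^ (2 * k) * (1 / z) ^ (2 * j + 1) = z ^ (2 * (k - 1 - j) + 1)"
      using assms(2) by (simp add: power_divide)
    moreover have "half_coeff k (k - 1 - j) = (-1) ^ k * half_coeff k j"
      using that by (intro half_coeff_symmetric) auto
    ultimately show ?thesis
      unfolding h_def by (simp only: of_real_mult mult_ac)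
  qed
  then have h: "(\<Sum>j<k. h j) = (\<Sum>j < k div 2. h j) + of_real ((-1) ^ k) * z ^ (2 * k)
      * (\<Sum>j < k div 2. of_real (half_coeff k j) * (1 / z) ^ (2 * j + 1))"
    unfolding sum_distrib_left by (subst sum_symmetric_halves) (auto simp: h_def half_coeff_middle)
  have "2 * k = 2 + (2 * k - 2)" using assms by simp
  then have "z ^ (2 * k) = z\<^sup>2 * z ^ (2 * k - 2)" by (metis power_add)
  then have L: "(1 + z\<^sup>2) * (1 + (-1) ^ k * z ^ (2 * k - 2))
      = (1 + z\<^sup>2) + of_real ((-1) ^ k) * z ^ (2 * k) * (1 + (1 / z)\<^sup>2)"
    using assms(2) by (simp add: field_simps)
  have "poly ([:1, 0, 1:] * reduced_poly k) z
      = of_real (lam (2 * k - 1)) * ((1 + z\<^sup>2) * (1 + (-1) ^ k * z ^ (2 * k - 2)))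
        + of_real (4 / pi) * ((1 + z\<^sup>2) * (\<Sum>j = 1..<k. of_real ((-1) ^ j * conv_coeff k j) * z ^ (2 * j - 1)))"
    by (simp add: poly_reduced_poly power2_eq_square algebra_simps)
  also have "(1 + z\<^sup>2) * (\<Sum>j = 1..<k. of_real ((-1) ^ j * conv_coeff k j) * z ^ (2 * j - 1)) = (\<Sum>j<k. h j)"
    unfolding h_def by (rule telescoped_conv_sum[OF assms(1)])
  also note h
  also note L
  finally show ?thesis
    unfolding poly_half_poly h_def by (simp add: algebra_simps)
qed

section \<open>The half polynomial has no zeros in the closed unit disc\<close>

lemma lam_4_le: "lam 4 \<le> 10148 / 10000"
proof -
  have "pi ^ 4 \<le> (3.1416 :: real) ^ 4"
    using pi_approx by (intro power_mono) auto
  then show ?thesis unfolding lam_4 by (simp add: power_divide)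
qed

lemma lam_le_geometric:
  assumes "i + 4 \<le> s"
  shows "lam s \<le> 1 + 148 / 10000 / 3 ^ i"
proof -
  have "lam s - 1 \<le> (lam 4 - 1) / 3 ^ (s - 4)" using assms by (intro lam_le) auto
  also have "\<dots> \<le> (148 / 10000) / 3 ^ i"
    using lam_4_le assms by (intro frac_le power_increasing) auto
  finally show ?thesis by simp
qed

lemma lam_mult_le:
  assumes "i + 4 \<le> s" "i + 4 \<le> t"
  shows "lam s * lam t \<le> 1 + 3 / 100 / 3 ^ i"
proof -
  define e where "e = 148 / 10000 / (3::real) ^ i"
  have "e \<le> 148 / 10000 / 3 ^ 0"
    unfolding e_def by (intro divide_left_mono power_increasing) auto
  then have e: "0 \<le> e" "e \<le> 148 / 10000" by (auto simp: e_def)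
  have "lam s * lam t \<le> (1 + e) * (1 + e)"
    using lam_le_geometric[OF assms(1)] lam_le_geometric[OF assms(2)] lam_ge_1[of t] assms e
    by (intro mult_mono) (auto simp: e_def)
  also have "\<dots> = 1 + (2 + e) * e" by (simp add: algebra_simps)
  \<comment> \<open>The constant is the ratio of \<open>3 / 100\<close> to
    \<open>148 / 10000\<close>, slightly above 2.0148.\<close>
  also have "(2 + e) * e \<le> (3 / 148 * 100) * e" using e by (intro mult_right_mono) auto
  finally show ?thesis by (simp add: e_def)
qed

text \<open>Both values of \<open>conv_coeff\<close> lie just above 1, within the stated distance.
  The bound on \<open>j\<close> keeps \<open>k - i\<close> at least \<open>i\<close> for
  \<open>i = j\<close> and \<open>i = Suc j\<close>, so the smaller argument \<open>2 * i\<close>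
  governs the decay.\<close>

lemma half_coeff_tail:
  assumes "2 \<le> j" "j < k div 2"
  shows "\<bar>half_coeff k j\<bar> \<le> 3 / 100 / 9 ^ (j - 2)"
proof -
  have jk: "Suc j < k" "2 * Suc j \<le> k" using assms by auto
  have c: "conv_coeff k i = lam (2 * i) * lam (2 * (k - i))" if "i = j \<or> i = Suc j" for i
    using that assms jk by (auto simp: conv_coeff_def)
  have ge: "conv_coeff k i \<ge> 1" if "i = j \<or> i = Suc j" for i
  proof -
    have "1 * 1 \<le> lam (2 * i) * lam (2 * (k - i))"
      using that assms jk by (intro mult_mono lam_ge_1) (auto intro!: order_trans[OF zero_le_one lam_ge_1])
    then show ?thesis using c[OF that] by simp
  qed
  have le: "conv_coeff k i \<le> 1 + 3 / 100 / 9 ^ (i - 2)" if "i = j \<or> i = Suc j" for i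
  proof -
    have "lam (2 * i) * lam (2 * (k - i)) \<le> 1 + 3 / 100 / 3 ^ (2 * (i - 2))"
      using that assms jk by (intro lam_mult_le) auto
    then show ?thesis by (simp add: c[OF that] power_mult)
  qed
  have "(3 / 100 / 9 ^ (Suc j - 2) :: real) \<le> 3 / 100 / 9 ^ (j - 2)"
    by (intro divide_left_mono power_increasing) auto
  then have "\<bar>conv_coeff k j - conv_coeff k (Suc j)\<bar> \<le> 3 / 100 / 9 ^ (j - 2)"
    using ge[of j] ge[of "Suc j"] le[of j] le[of "Suc j"] by (simp add: abs_le_iff)
  then show ?thesis by (simp add: half_coeff_def abs_mult power_abs)
qed

lemma sum_half_coeff_tail: "(\<Sum>j = 2..<k div 2. \<bar>half_coeff k j\<bar>) \<le> 34 / 1000"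
proof -
  have "(\<Sum>j = 2..<k div 2. \<bar>half_coeff k j\<bar>) \<le> (\<Sum>j = 2..<k div 2. 3 / 100 / 9 ^ (j - 2))"
    by (intro sum_mono half_coeff_tail) auto
  also have "\<dots> = (\<Sum>j < k div 2 - 2. 3 / 100 * (1 / 9) ^ j)"
    by (rule sum.reindex_bij_witness[of _ "\<lambda>j. j + 2" "\<lambda>j. j - 2"]) (auto simp: power_divide)
  also have "\<dots> = 3 / 100 * (\<Sum>j < k div 2 - 2. (1 / 9) ^ j)"
    by (simp only: sum_distrib_left)
  also have "(\<Sum>j < k div 2 - 2. (1 / 9) ^ j) = (1 - (1 / 9 :: real) ^ (k div 2 - 2)) / (8 / 9)"
    by (subst sum_gp_strict) simp
  also have "3 / 100 * \<dots> \<le> 3 / 100 * (9 / 8)"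
    by (intro mult_left_mono) auto
  finally show ?thesis by simp
qed

text \<open>The cubic is a model for \<open>half_poly k\<close> at \<open>- u\<close>, chosen in
  factored form with convenient decimals so that its modulus can be bounded below factor by
  factor.\<close>

lemma norm_cubic_ge:
  fixes u :: complex
  assumes "norm u \<le> 1"
  shows "norm ((1 + 7 / 10 * u) * (1 + 87 / 100 * u + 39 / 100 * u\<^sup>2)) \<ge> 11 / 100"
proof -
  have pw: "norm (c * u ^ n) \<le> norm c" for c n
    using assms by (simp add: norm_mult norm_power mult_left_le power_le_one)
  have 1: "norm (1 + 7 / 10 * u) \<ge> 3 / 10"
    using norm_triangle_ineq2[of 1 "- (7 / 10 * u)"] pw[of "7 / 10" 1] by simp
  define q where "q = 1 + 87 / 100 * u + 39 / 100 * u\<^sup>2"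
  \<comment> \<open>\<open>m\<close> is the Taylor polynomial of degree 2 of \<open>1 / q\<close>, so \<open>m q\<close> is nearly constant.\<close>
  define m where "m = 1 - 87 / 100 * u + 3669 / 10000 * u\<^sup>2"
  have m: "norm m \<le> 22369 / 10000"
  proof -
    have "norm m \<le> norm (1 - 87 / 100 * u) + norm (3669 / 10000 * u\<^sup>2)"
      unfolding m_def by (rule norm_triangle_ineq)
    also have "norm (1 - 87 / 100 * u) \<le> 1 + norm (87 / 100 * u)"
      using norm_triangle_ineq4[of 1 "87 / 100 * u"] by simp
    finally show ?thesis using pw[of "87 / 100" 1] pw[of "3669 / 10000" 2] by simp
  qed
  have "m * q = 1 - (20097 / 1000000 * u ^ 3 - 143091 / 1000000 * u ^ 4)"
    by (simp add: m_def q_def power2_eq_square power3_eq_cube power4_eq_xxxx algebra_simps)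
  then have "norm (m * q) \<ge> 1 - norm (20097 / 1000000 * u ^ 3 - 143091 / 1000000 * u ^ 4)"
    using norm_triangle_ineq2[of 1 "20097 / 1000000 * u ^ 3 - 143091 / 1000000 * u ^ 4"] by simp
  moreover have "norm (20097 / 1000000 * u ^ 3 - 143091 / 1000000 * u ^ 4) \<le> 163188 / 1000000"
    using norm_triangle_ineq4[of "20097 / 1000000 * u ^ 3" "143091 / 1000000 * u ^ 4"]
      pw[of "20097 / 1000000" 3] pw[of "143091 / 1000000" 4] by simp
  ultimately have "norm m * norm q \<ge> 836812 / 1000000" by (simp add: norm_mult)
  moreover have "norm m * norm q \<le> 22369 / 10000 * norm q"
    by (intro mult_right_mono m) auto
  ultimately have q: "norm q \<ge> 37 / 100" by simp
  have "3 / 10 * (37 / 100) \<le> norm (1 + 7 / 10 * u) * norm q"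
    by (intro mult_mono 1 q) auto
  then show ?thesis by (simp add: q_def norm_mult)
qed

text \<open>Comparison with the model cubic: the four coefficient errors and the tail
  \<open>T\<close> add up to less than 0.065, below the lower bound 0.11 of
  \<open>norm_cubic_ge\<close>.\<close>

lemma half_poly_nonzero_in_disc:
  assumes k: "k \<ge> 4" and z: "norm z \<le> 1"
  shows "poly (half_poly k) z \<noteq> 0"
proof
  assume 0: "poly (half_poly k) z = 0"
  define L where "L = lam (2 * k - 1)"
  define b where "b = - (4 / pi * half_coeff k 0)"
  define d where "d = - (4 / pi * half_coeff k 1)"
  define T where "T = of_real (4 / pi) * (\<Sum>j = 2..<k div 2. of_real (half_coeff k j) * z ^ (2 * j + 1))"
  \<comment> \<open>With this sign the coefficients \<open>b\<close> and \<open>d\<close> of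
    \<open>u\<close> and \<open>u ^ 3\<close> are positive.\<close>
  define u where "u = - z"
  have u: "norm u \<le> 1" using z by (simp add: u_def)
  have pi1: "3.1415 \<le> pi" "pi \<le> 3.1416" using pi_approx by simp_all
  have ones: "1 \<le> L" "1 \<le> lam (2 * k - 2)" "1 \<le> lam (2 * k - 4)"
    using k by (auto simp: L_def intro!: lam_ge_1)
  have "3 + 4 \<le> 2 * k - 1" "2 + 4 \<le> 2 * k - 2" "0 + 4 \<le> 2 * k - 4" using k by linarith+
  note bounds = this[THEN lam_le_geometric]
  have L: "L \<le> 1 + 6 / 10000" using bounds(1) by (simp add: L_def)
  have l2: "lam (2 * k - 2) \<le> 1 + 17 / 10000" using bounds(2) by simp
  have l4: "lam (2 * k - 4) \<le> 1 + 148 / 10000" using bounds(3) by simp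
  have c1: "conv_coeff k (Suc 0) = pi\<^sup>2 / 8 * lam (2 * k - 2)"
    using k by (simp add: conv_coeff_def lam_2 diff_mult_distrib2)
  have c2: "conv_coeff k (Suc (Suc 0)) = pi ^ 4 / 96 * lam (2 * k - 4)"
    using k by (simp add: conv_coeff_def lam_4 diff_mult_distrib2)
  have b_eq: "b = pi / 2 * lam (2 * k - 2)"
    by (simp add: b_def half_coeff_def c1 conv_coeff_def[of k 0] power2_eq_square)
  have d_eq: "d = b - pi ^ 3 / 24 * lam (2 * k - 4)"
    unfolding b_eq by (simp add: d_def half_coeff_def c1 c2
        power2_eq_square power3_eq_cube power4_eq_xxxx field_simps)
  have "pi / 2 * 1 \<le> b" unfolding b_eq using ones by (intro mult_left_mono) auto
  moreover have "b \<le> (3.1416 / 2) * (1 + 17 / 10000)"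
    unfolding b_eq using pi1 l2 ones by (intro mult_mono) auto
  ultimately have b: "1.57 \<le> b" "b \<le> 1.574" "1.57075 \<le> b" using pi1 by auto
  have "3.1415 ^ 3 / 24 * 1 \<le> pi ^ 3 / 24 * lam (2 * k - 4)"
    using pi1 ones by (intro mult_mono divide_right_mono power_mono) auto
  moreover have "pi ^ 3 / 24 * lam (2 * k - 4) \<le> 3.1416 ^ 3 / 24 * (1 + 148 / 10000)"
    using pi1 l4 ones by (intro mult_mono divide_right_mono power_mono) auto
  ultimately have d: "0.259 \<le> d" "d \<le> 0.283"
    unfolding d_eq using b by (simp_all add: power3_eq_cube)
  have T: "norm T \<le> 0.044"
  proof -
    have "norm (\<Sum>j = 2..<k div 2. of_real (half_coeff k j) * z ^ (2 * j + 1))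
        \<le> (\<Sum>j = 2..<k div 2. \<bar>half_coeff k j\<bar>)"
    proof (rule sum_norm_le)
      fix j
      show "norm (of_real (half_coeff k j) * z ^ (2 * j + 1)) \<le> \<bar>half_coeff k j\<bar>"
        unfolding norm_mult norm_power norm_of_real using z by (intro mult_left_le power_le_one) auto
    qed
    also have "\<dots> \<le> 34 / 1000" by (rule sum_half_coeff_tail)
    finally have "norm T \<le> 4 / pi * (34 / 1000)"
      unfolding T_def norm_mult by (intro mult_mono) (auto simp: norm_divide)
    also have "\<dots> \<le> 0.044" using pi1 by (simp add: field_simps)
    finally show ?thesis .
  qed
  \<comment> \<open>As \<open>k\<close> is at least 4, the indices 0 and 1 both occur and can be
    split off from the tail.\<close>
  have "{..<k div 2} = {0, 1} \<union> {2..<k div 2}" using k by auto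
  then have "(\<Sum>j < k div 2. of_real (half_coeff k j) * z ^ (2 * j + 1))
      = of_real (half_coeff k 0) * z + of_real (half_coeff k 1) * z ^ 3
        + (\<Sum>j = 2..<k div 2. of_real (half_coeff k j) * z ^ (2 * j + 1))"
    by (simp add: sum.union_disjoint eval_nat_numeral)
  then have "poly (half_poly k) z = of_real L * (1 + u\<^sup>2) + of_real b * u + of_real d * u ^ 3 + T"
    unfolding poly_half_poly by (simp add: L_def b_def d_def T_def u_def algebra_simps)
  with 0 have "of_real L * (1 + u\<^sup>2) + of_real b * u + of_real d * u ^ 3 + T = 0" by simp
  moreover have "(1 + 7 / 10 * u) * (1 + 87 / 100 * u + 39 / 100 * u\<^sup>2)
      = 1 + 157 / 100 * u + 999 / 1000 * u\<^sup>2 + 273 / 1000 * u ^ 3"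
    by (simp add: field_simps power2_eq_square power3_eq_cube)
  ultimately have "(1 + 7 / 10 * u) * (1 + 87 / 100 * u + 39 / 100 * u\<^sup>2)
      = - (of_real (L - 1) * u ^ 0 + of_real (b - 1.57) * u ^ 1 + of_real (L - 0.999) * u ^ 2 + of_real (d - 0.273) * u ^ 3 + T)"
    by (simp add: algebra_simps eq_neg_iff_add_eq_0)
  then have "11 / 100 \<le> norm (of_real (L - 1) * u ^ 0 + of_real (b - 1.57) * u ^ 1 + of_real (L - 0.999) * u ^ 2 + of_real (d - 0.273) * u ^ 3 + T)"
    using norm_cubic_ge[OF u] by (metis norm_minus_cancel)
  also have "\<dots> \<le> \<bar>L - 1\<bar> + \<bar>b - 1.57\<bar> + \<bar>L - 0.999\<bar> + \<bar>d - 0.273\<bar> + 0.044"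
  proof -
    have "norm (of_real c * u ^ n) \<le> \<bar>c\<bar>" for c :: real and n
      unfolding norm_mult norm_power norm_of_real using u by (intro mult_left_le power_le_one) auto
    then show ?thesis by (intro norm_triangle_le add_mono T) 
  qed
  also have "\<dots> < 11 / 100"
    using L ones b d by (simp add: abs_if)
  finally show False by simp
qed

section \<open>Location and simplicity of the zeros\<close>

lemma order_eq_1I:
  fixes p :: "'a :: idom poly"
  assumes "poly p a = 0" "poly (pderiv p) a \<noteq> 0"
  shows "order a p = 1"
proof -
  have p0: "p \<noteq> 0" using assms(2) by auto
  obtain q where q: "p = [:-a, 1:] * q" using assms(1) by (auto simp: poly_eq_0_iff_dvd elim: dvdE)
  have "poly (pderiv p) a = poly q a"
    unfolding q pderiv_mult by (simp add: pderiv_pCons)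
  then have "order a q = 0" using assms(2) by (simp add: order_0I)
  moreover have "order a [:-a, 1:] = 1" using order_power_n_n[of a 1] by simp
  ultimately show ?thesis using p0 unfolding q by (subst order_mult) auto
qed

text \<open>The discriminant \<open>b^2 - 4 * L^2\<close> is negative, so the zeros form a non-real
  conjugate pair with product 1. The second conclusion says that the derivative does not vanish; its
  vanishing would make \<open>z\<close> real.\<close>

lemma quadratic_zeros_on_circle:
  fixes L b :: real and z :: complex
  assumes "\<bar>b\<bar> < 2 * L" "of_real L * (1 + z\<^sup>2) - of_real b * z = 0"
  shows "norm z = 1" "2 * of_real L * z \<noteq> of_real b"
proof -
  have L: "L > 0" using assms(1) by linarith
  define x y where "x = Re z" and "y = Im z"
  have re: "L * (1 + x\<^sup>2 - y\<^sup>2) = b * x" and im: "2 * L * x * y = b * y"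
    using assms(2) by (auto simp: complex_eq_iff x_def y_def power2_eq_square algebra_simps)
  have y: "y \<noteq> 0"
  proof
    assume "y = 0"
    with re have "L * (1 + x\<^sup>2) = b * x" by simp
    also have "b * x \<le> \<bar>b\<bar> * \<bar>x\<bar>" by (metis abs_ge_self abs_mult)
    also have "\<dots> \<le> 2 * L * \<bar>x\<bar>" using assms(1) by (intro mult_right_mono) auto
    finally have "L * (1 - \<bar>x\<bar>)\<^sup>2 \<le> 0" by (simp add: power2_eq_square algebra_simps)
    then have x: "\<bar>x\<bar> = 1" using L by (simp add: mult_le_0_iff)
    then have "x\<^sup>2 = 1" by (metis power2_abs one_power2)
    with \<open>L * (1 + x\<^sup>2) = b * x\<close> have "2 * L = b * x" by simp
    also have "\<dots> \<le> \<bar>b\<bar>" using \<open>b * x \<le> \<bar>b\<bar> * \<bar>x\<bar>\<close> x by simp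
    finally show False using assms(1) by simp
  qed
  with im have b: "b = 2 * L * x" by simp
  with re have "L * (x\<^sup>2 + y\<^sup>2) = L * 1" by (simp add: power2_eq_square algebra_simps)
  then have "x\<^sup>2 + y\<^sup>2 = 1" using L mult_left_cancel by (metis less_irrefl)
  then show "norm z = 1" by (simp add: cmod_def x_def y_def)
  show "2 * of_real L * z \<noteq> of_real b"
    using y L by (auto simp: complex_eq_iff y_def)
qed

section \<open>Explicit factorisations for k = 2 and k = 3\<close>

lemma reduced_poly_2:
  "reduced_poly 2 = [:of_real (lam 3), - of_real (4 / pi * (lam 2 * lam 2)), of_real (lam 3):]"
proof -
  have "{1..<2::nat} = {1}" by auto
  then show ?thesis
    unfolding reduced_poly_def
    by (simp add: conv_coeff_def monom_altdef numeral_2_eq_2 numeral_3_eq_3)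
qed

text \<open>Here both 1 - z^4 and z - z^3 are divisible by 1 - z^2.\<close>

lemma reduced_poly_3:
  "reduced_poly 3 = [:1, 0, -1:] *
     [:of_real (lam 5), - of_real (4 / pi * (lam 2 * lam 4)), of_real (lam 5):]"
proof -
  have "{1..<3::nat} = {1, 2}" by auto
  then have "poly (reduced_poly 3) z = poly ([:1, 0, -1:] *
     [:of_real (lam 5), - of_real (4 / pi * (lam 2 * lam 4)), of_real (lam 5):]) z" for z
    unfolding poly_reduced_poly by (simp add: conv_coeff_def eval_nat_numeral algebra_simps)
  then show ?thesis by (subst poly_eq_poly_eq_iff[symmetric]) auto
qed

lemma reduced_poly_zeros:
  assumes k: "k \<ge> 2" and z: "poly (reduced_poly k) z = 0"
  shows "norm z = 1 \<and> poly (pderiv (reduced_poly k)) z \<noteq> 0"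
proof -
  have pi1: "pi \<le> 3.1416" "pi > 0" using pi_approx by simp_all
  consider "k = 2" | "k = 3" | "k \<ge> 4" using k by linarith
  then show ?thesis
  proof cases
    case 1
    define b where "b = 4 / pi * (lam 2 * lam 2)"
    have "b = pi ^ 3 / 16" by (simp add: b_def lam_2 power2_eq_square power3_eq_cube)
    also have "\<dots> \<le> 3.1416 ^ 3 / 16" using pi1 by (intro divide_right_mono power_mono) auto
    \<comment> \<open>As \<open>b\<close> is about 1.94, the crude bound
      \<open>lam 3 \<ge> 1\<close> is enough.\<close>
    finally have "b < 2 * lam 3" using lam_ge_1[of 3] by (simp add: power3_eq_cube)
    moreover have "b \<ge> 0" by (simp add: b_def lam_2)
    ultimately have b: "\<bar>b\<bar> < 2 * lam 3" by simp
    have R: "reduced_poly k = [:of_real (lam 3), - of_real b, of_real (lam 3):]"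
      unfolding 1 reduced_poly_2 b_def ..
    have "of_real (lam 3) * (1 + z\<^sup>2) - of_real b * z = 0"
      using z unfolding R by (simp add: algebra_simps power2_eq_square)
    from quadratic_zeros_on_circle[OF b this] show ?thesis
      unfolding R by (simp add: pderiv_pCons algebra_simps)
  next
    case 2
    define b where "b = 4 / pi * (lam 2 * lam 4)"
    have "b = pi ^ 5 / 192" unfolding b_def lam_2 lam_4 by (simp add: eval_nat_numeral)
    also have "\<dots> \<le> 3.1416 ^ 5 / 192" using pi1 by (intro divide_right_mono power_mono) auto
    finally have "b < 2 * lam 5" using lam_ge_1[of 5] by (simp add: power_divide)
    moreover have "b \<ge> 0" by (simp add: b_def lam_2 lam_4)
    ultimately have b: "\<bar>b\<bar> < 2 * lam 5" by simp
    define q where "q = [:of_real (lam 5), - of_real b, of_real (lam 5) :: complex:]"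
    have R: "reduced_poly k = [:1, 0, -1:] * q"
      unfolding 2 reduced_poly_3 b_def q_def ..
    have q: "poly q w = of_real (lam 5) * (1 + w\<^sup>2) - of_real b * w" for w
      by (simp add: q_def algebra_simps power2_eq_square)
    have qz: "norm w = 1 \<and> poly (pderiv q) w \<noteq> 0" if "poly q w = 0" for w
      using quadratic_zeros_on_circle[OF b, of w] that unfolding q
      by (simp add: q_def pderiv_pCons algebra_simps)
    have pd: "poly (pderiv (reduced_poly k)) w = (1 - w\<^sup>2) * poly (pderiv q) w - 2 * w * poly q w" for w
      unfolding R pderiv_mult by (simp add: pderiv_pCons power2_eq_square algebra_simps)
    \<comment> \<open>The factors share no zero: at 1 and -1 the value of \<open>q\<close> is
      \<open>2 * lam 5\<close> minus or plus \<open>b\<close>.\<close>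
    have q1: "poly q w \<noteq> 0" if "w\<^sup>2 = 1" for w
    proof -
      have "w = 1 \<or> w = -1" using that by (simp add: power2_eq_1_iff)
      then have "poly q w = of_real (2 * lam 5 - b) \<or> poly q w = of_real (2 * lam 5 + b)"
        unfolding q by auto
      moreover have "2 * lam 5 - b \<noteq> 0" "2 * lam 5 + b \<noteq> 0" using b by auto
      ultimately show ?thesis by (metis of_real_eq_0_iff)
    qed
    have "1 - z\<^sup>2 = 0 \<or> poly q z = 0"
      using z unfolding R by (auto simp: power2_eq_square)
    then show ?thesis
    proof
      assume "1 - z\<^sup>2 = 0"
      then have z2: "z\<^sup>2 = 1" by simp
      then have "z = 1 \<or> z = -1" by (simp add: power2_eq_1_iff)
      then show ?thesis unfolding pd using q1[OF z2] by auto
    next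
      assume "poly q z = 0"
      then show ?thesis unfolding pd using qz[of z] q1[of z] by auto
    qed
  next
    case 3
    note k4 = 3
    have p0: "half_poly k \<noteq> 0"
      using half_poly_nonzero_in_disc[OF k4, of 0] by auto
    have out: "norm r > 1" if "poly (half_poly k) r = 0" for r
      using half_poly_nonzero_in_disc[OF k4, of r] that by force
    have eps: "(-1) ^ k = (1::real) \<or> (-1) ^ k = (-1::real)"
      by (cases "even k") auto
    have "poly (reduced_poly k) 0 = of_real (lam (2 * k - 1))"
      using k by (auto simp: poly_reduced_poly power_0_left intro!: sum.neutral)
    moreover have "lam (2 * k - 1) \<ge> 1" using k by (intro lam_ge_1) auto
    ultimately have z0: "z \<noteq> 0" using z by auto
    have N: "poly (half_poly k) z + of_real ((-1) ^ k) * z ^ (2 * k) * poly (half_poly k) (1 / z) = 0"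
      using reduced_poly_self_inversive[OF k z0] z by simp
    note facts = p0 out half_poly_coeff_real degree_half_poly[OF k] eps z0 N
    have "norm z = 1" by (rule self_inversive_zeros[OF facts])
    moreover have "poly (pderiv (reduced_poly k)) z \<noteq> 0"
    proof
      assume "poly (pderiv (reduced_poly k)) z = 0"
      \<comment> \<open>A multiple zero of the factor is a multiple zero of the product, even if
        \<open>z\<close> is also a zero of 1 + z^2.\<close>
      then have "poly (pderiv ([:1, 0, 1:] * reduced_poly k)) z = 0"
        using z unfolding pderiv_mult by simp
      then have "(poly ([:1, 0, 1:] * reduced_poly k) has_field_derivative 0) (at z)"
        using poly_DERIV by metis
      \<comment> \<open>The reflected form is valid only away from 0, so the derivative is
        transferred on the open set \<open>- {0}\<close>.\<close>
      then have "((\<lambda>z. poly (half_poly k) z + of_real ((-1) ^ k) * z ^ (2 * k) * poly (half_poly k) (1 / z))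
          has_field_derivative 0) (at z)"
        by (rule has_field_derivative_transform_within_open[where S = "- {0}"])
           (use z0 reduced_poly_self_inversive[OF k] in auto)
      then show False using self_inversive_simple[OF facts] by blast
    qed
    ultimately show ?thesis by blast
  qed
qed

theorem theorem4:
  fixes k :: nat
  assumes "k \<ge> 2"
  shows "(\<forall>z::complex. poly (Q k) z =
            of_real ((2 * pi) ^ (2 * k - 1) / fact (2 * k))
              * (\<Sum>j = 0..k. of_real ((-1) ^ j * bernoulli (2 * j) * bernoulli (2 * k - 2 * j)
                   * (2 ^ (2 * j) - 1) * (2 ^ (2 * k - 2 * j) - 1)
                   * of_nat ((2 * k) choose (2 * j))) * z ^ (2 * j))
            + zeta (2 * of_nat k - 1) * (2 ^ (2 * k - 1) - 1)
              * ((-1) ^ k * z + z ^ (2 * k - 1)))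
       \<and> (\<forall>z. poly (Q k) z = 0 \<and> z \<noteq> 0 \<longrightarrow> norm z = 1)
       \<and> (\<forall>z. poly (Q k) z = 0 \<longrightarrow> order z (Q k) = 1)"
proof (intro conjI allI impI)
  fix z :: complex
  show "poly (Q k) z =
            of_real ((2 * pi) ^ (2 * k - 1) / fact (2 * k))
              * (\<Sum>j = 0..k. of_real ((-1) ^ j * bernoulli (2 * j) * bernoulli (2 * k - 2 * j)
                   * (2 ^ (2 * j) - 1) * (2 ^ (2 * k - 2 * j) - 1)
                   * of_nat ((2 * k) choose (2 * j))) * z ^ (2 * j))
            + zeta (2 * of_nat k - 1) * (2 ^ (2 * k - 1) - 1)
              * ((-1) ^ k * z + z ^ (2 * k - 1))"
    using assms by (intro poly_Q) auto
next
  fix z :: complex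
  assume "poly (Q k) z = 0 \<and> z \<noteq> 0"
  then have "poly (reduced_poly k) z = 0"
    unfolding Q_eq_reduced_poly[OF assms] by auto
  then show "norm z = 1" using reduced_poly_zeros[OF assms] by blast
next
  fix z :: complex
  assume z: "poly (Q k) z = 0"
  define K where "K = (of_real (2 ^ (2 * k - 1) * (-1) ^ k) :: complex)"
  have K: "K \<noteq> 0" by (simp add: K_def)
  have Q: "Q k = smult K ([:0, 1:] * reduced_poly k)"
    unfolding K_def by (rule Q_eq_reduced_poly[OF assms])
  have D: "poly (pderiv (Q k)) z = K * (poly (reduced_poly k) z + z * poly (pderiv (reduced_poly k)) z)"
    unfolding Q pderiv_smult pderiv_mult by (simp add: pderiv_pCons algebra_simps)
  show "order z (Q k) = 1"
  proof (rule order_eq_1I[OF z])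
    show "poly (pderiv (Q k)) z \<noteq> 0"
    \<comment> \<open>A zero of \<open>reduced_poly k\<close> has norm 1, so the factor
      \<open>z\<close> in the derivative is nonzero; the only other zero is 0, where the derivative
      is \<open>K\<close> times the nonzero value of \<open>reduced_poly k\<close>.\<close>
    proof (cases "poly (reduced_poly k) z = 0")
      case True
      with reduced_poly_zeros[OF assms True] show ?thesis unfolding D using K by auto
    next
      case False
      then have "z = 0" using z K unfolding Q by simp
      then show ?thesis unfolding D using K False by simp
    qed
  qed
qed

end
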